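(* Let $d\ge 1$ be an integer and let $\gamma>1$. Consider non-negative functions $g\in L^q(Q_\gamma)$ and $h\in L^\sigma(Q_\gamma)$ for some $\sigma>q>1$. Assume that there are $b>1$ and $\theta\in(0,1)$ such that for all $R>0$ and all $z_0\in Q_\gamma$ with $Q_{\gamma R}(z_0)\subset Q_\gamma$, $$\frac{1}{|Q_R(z_0)|}\int_{Q_R(z_0)} g^q \le b\left\{\left(\frac{1}{|Q_{\gamma R}(z_0)|}\int_{Q_{\gamma R}(z_0)} g\right)^q+\frac{1}{|Q_{\gamma R}(z_0)|}\int_{Q_{\gamma R}(z_0)} h^q\right\}+\theta\,\frac{1}{|Q_{\gamma R}(z_0)|}\int_{Q_{\gamma R}(z_0)} g^q .$$ If $\theta<\theta_0:=\left[2\,(75)^{4d+2}\,4^q\right]^{-1}$ and $q<p^*:=\min\left(\sigma,\frac{bq-\theta_0}{b-\theta_0}\right)$, then $g\in L^p(Q_1)$ for every $p\in[q,p^* )$, and $$\left(\frac{1}{|Q_1|}\int_{Q_1} g^p\right)^{1/p}\le C_{\mathrm G}\left(\left(\frac{1}{|Q_\gamma|}\int_{Q_\gamma} g^q\right)^{1/q}+\left(\frac{1}{|Q_\gamma|}\int_{Q_\gamma} h^p\right)^{1/p}\right),$$ where the constant $C_{\mathrm G}$ depends only on $b,\theta,p,q,\gamma,d$.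
   Context: Points of $\mathbb R\times\mathbb R^d\times\mathbb R^d$ are written $z=(t,x,v)$. For $r>0$, $B_r$ is the open Euclidean ball of $\mathbb R^d$ centered at the origin with radius $r$. The kinetic cylinders are $Q_r=(-r^2,0]\times B_{r^3}\times B_r$ and, for $z_0=(t_0,x_0,v_0)$, $$Q_r(z_0)=\{(t,x,v): -r^2<t-t_0\le 0,\ |x-x_0-(t-t_0)v_0|<r^3,\ |v-v_0|<r\}.$$ $|Q|$ denotes the Lebesgue measure of $Q$. *)

theory Defs
  imports "HOL-Analysis.Analysis"
begin

type_synonym 'd phase = "real \<times> (real ^ 'd) \<times> (real ^ 'd)"

definition kin_cyl0 :: "real \<Rightarrow> ('d::finite) phase set" where
  "kin_cyl0 r = {- (r\<^sup>2)<..0} \<times> ball 0 (r ^ 3) \<times> ball 0 r"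

fun kin_cyl :: "real \<Rightarrow> ('d::finite) phase \<Rightarrow> 'd phase set" where
  "kin_cyl r (t0, x0, v0) =
     {(t, x, v). - (r\<^sup>2) < t - t0 \<and> t - t0 \<le> 0 \<and>
                 norm (x - x0 - (t - t0) *\<^sub>R v0) < r ^ 3 \<and> norm (v - v0) < r}"

lemma kin_cyl_origin: "kin_cyl r (0, 0, 0) = kin_cyl0 r"
  by (auto simp: kin_cyl0_def dist_norm)

text \<open>Integrability of a concrete real-valued function on \<open>S\<close>; no quotient by null sets is taken.\<close>

definition in_Lp :: "real \<Rightarrow> ('a::euclidean_space) set \<Rightarrow> ('a \<Rightarrow> real) \<Rightarrow> bool" where
  "in_Lp p S f \<longleftrightarrow>
     f \<in> borel_measurable (lebesgue_on S) \<and>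
     integrable (lebesgue_on S) (\<lambda>z. \<bar>f z\<bar> powr p)"

definition mean :: "('a::euclidean_space) set \<Rightarrow> ('a \<Rightarrow> real) \<Rightarrow> real" where
  "mean S f = (1 / measure lebesgue S) * (LINT z|lebesgue_on S. f z)"

definition theta0 :: "nat \<Rightarrow> real \<Rightarrow> real" where
  "theta0 d q = inverse (2 * 75 ^ (4 * d + 2) * 4 powr q)"

definition pstar :: "nat \<Rightarrow> real \<Rightarrow> real \<Rightarrow> real \<Rightarrow> real" where
  "pstar d b q \<sigma> = min \<sigma> ((b * q - theta0 d q) / (b - theta0 d q))"

end

(*
A Gehring argument with a stopping time in place of a maximal function. Write F = g^q and fix
radii 1 <= s < r <= gamma and a level lam that is large in terms of r - s. Almost every point of
Q_s where g > lam lies in a cylinder contained in Q_r over which the mean of F exceeds lam^q; take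
one of almost maximal radius R. The mean over its gamma-dilate is then at most lam^q, so the
theta-term of the reverse Hoelder inequality is absorbed, and either the mean of g over the dilate
is at least 2 lam / c with c = 2 (4b)^(1/q), or the mean of h^q is at least lam^q / (4b).
A Vitali covering by the dilates turns this into
  int_{Q_s, g > lam} F <= 3^n (c lam^(q-1) int_{Q_r, c g > lam} g
                               + 8b int_{Q_r, (8b)^(1/q) h > lam} h^q),   n = 4d + 2.
Multiplying by (p-q) lam^(p-q-1) and integrating in lam bounds Phi(s) = int_{Q_s} F min(g,k)^(p-q)
by kappa Phi(r) + ..., where kappa = 3^n c^p (p-q)/(p-1). Since c^p is essentially linear in b, the
condition p < (bq - theta0)/(b - theta0), that is b (p-q) < theta0 (p-1), gives kappa < 1. A
hole-filling iteration over radii and k -> infinity finish the proof.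
*)
theory Submission
  imports Defs
begin

section \<open>Geometry and volume of kinetic cylinders\<close>

text \<open>The competitors at a point z are all cylinders inside the domain with z in their
  interior, wherever their centres are. Cylinders reach only into the past and are sheared along the
  velocity of their centre, and the non-centred family is what makes the covering close up: the
  dilate Q of a stopping cylinder and the tripled cylinder E that engulfs its neighbours are
  competitors at the same point, and both are too large to be admissible. Hence the integral of F
  over E is at most 3^n lam^q |Q|, which involves only the disjoint dilates Q. Using interiors,
  compactness reduces everything to finite subcovers. Largeness of lam makes the stopping radii
  small against r - s, so that all these cylinders stay in Q_r. The price is a term for the low
  levels that blows up like a power of 1/(r - s); hole filling tolerates any such power. The
  truncation at k makes Phi finite beforehand, without which kappa Phi(r) could not be absorbed. The
  exponent n = 2 + 3d + d is the scaling dimension of time, position and velocity.\<close>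

lemma kin_cyl_eq_Collect:
  fixes x0 v0 :: "real ^ 'd"
  shows "kin_cyl r (t0, x0, v0) =
    {z. - (r\<^sup>2) < fst z - t0 \<and> fst z - t0 \<le> 0 \<and>
        norm (fst (snd z) - x0 - (fst z - t0) *\<^sub>R v0) < r ^ 3 \<and> norm (snd (snd z) - v0) < r}"
  by auto

lemma kin_cyl_borel [measurable]: "kin_cyl r z \<in> sets borel"
proof (cases z)
  case (fields t0 x0 v0)
  have "(\<lambda>z::'a phase. norm (fst (snd z) - x0 - (fst z - t0) *\<^sub>R v0)) \<in> borel_measurable borel"
       "(\<lambda>z::'a phase. norm (snd (snd z) - v0)) \<in> borel_measurable borel"
       "(\<lambda>z::'a phase. fst z - t0) \<in> borel_measurable borel"
    by (intro borel_measurable_continuous_onI continuous_intros)+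
  then have [measurable]: "Measurable.pred borel (\<lambda>z::'a phase. - (r\<^sup>2) < fst z - t0)"
    "Measurable.pred borel (\<lambda>z::'a phase. fst z - t0 \<le> 0)"
    "Measurable.pred borel (\<lambda>z::'a phase. norm (fst (snd z) - x0 - (fst z - t0) *\<^sub>R v0) < r ^ 3)"
    "Measurable.pred borel (\<lambda>z::'a phase. norm (snd (snd z) - v0) < r)"
    by measurable
  have "Measurable.pred borel (\<lambda>z::'a phase. - (r\<^sup>2) < fst z - t0 \<and> fst z - t0 \<le> 0 \<and>
        norm (fst (snd z) - x0 - (fst z - t0) *\<^sub>R v0) < r ^ 3 \<and> norm (snd (snd z) - v0) < r)"
    by measurable
  then show ?thesis
    unfolding fields kin_cyl_eq_Collect by (simp add: pred_def)
qed

text \<open>The volume of the cylinder of radius 1: time has length 1, position and velocity each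
  range over a unit ball of R^d.\<close>

definition cyl_vol :: "'d::finite itself \<Rightarrow> real" where
  "cyl_vol _ = (unit_ball_vol (real CARD('d)))\<^sup>2"

lemma cyl_vol_pos: "cyl_vol TYPE('d::finite) > 0"
proof -
  have "unit_ball_vol (real CARD('d)) > 0" by (rule unit_ball_vol_pos) simp
  then show ?thesis unfolding cyl_vol_def by (rule zero_less_power)
qed

text \<open>Cavalieri in time: at fixed t the slice is a product of two balls, since the shear
  merely translates the position ball. The exponent collects 2 from time, 3d from position and d
  from velocity.\<close>

lemma emeasure_kin_cyl:
  fixes z :: "'d::finite phase"
  assumes "r \<ge> 0"
  shows "emeasure lborel (kin_cyl r z) = ennreal (r ^ (4 * CARD('d) + 2) * cyl_vol TYPE('d))"
proof (cases z)
  case (fields t0 x0 v0)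
  let ?n = "CARD('d)" and ?u = "unit_ball_vol (real CARD('d))"
  have slice: "Pair t -` kin_cyl r z = (if t \<in> {t0 - r\<^sup>2<..t0} then ball (x0 + (t - t0) *\<^sub>R v0) (r ^ 3) \<times> ball v0 r else {})" for t
    by (auto simp: fields dist_norm norm_minus_commute algebra_simps)
  have b: "emeasure lborel (ball c s :: (real^'d) set) = ennreal (?u * s ^ ?n)" if "s \<ge> 0" for c s
    using emeasure_ball[OF that, of c] by simp
  have *: "emeasure lborel (Pair t -` kin_cyl r z) =
      ennreal (?u\<^sup>2 * r ^ (4 * ?n)) * indicator {t0 - r\<^sup>2<..t0} t" for t
  proof (cases "t \<in> {t0 - r\<^sup>2<..t0}")
    case True
    have "emeasure lborel (ball (x0 + (t - t0) *\<^sub>R v0) (r ^ 3) \<times> ball v0 r) =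
        emeasure lborel (ball (x0 + (t - t0) *\<^sub>R v0) (r ^ 3)) * emeasure lborel (ball v0 r)"
      unfolding lborel_prod[symmetric] by (rule lborel.emeasure_pair_measure_Times) auto
    also have "\<dots> = ennreal (?u * (r ^ 3) ^ ?n * (?u * r ^ ?n))"
      using assms by (simp add: b ennreal_mult)
    also have "?u * (r ^ 3) ^ ?n * (?u * r ^ ?n) = ?u\<^sup>2 * r ^ (4 * ?n)"
      by (simp add: power2_eq_square power_mult[symmetric] power_add[symmetric])
    finally show ?thesis using True slice by simp
  qed (simp only: slice if_False emeasure_empty, simp)
  have "kin_cyl r z \<in> sets (lborel \<Otimes>\<^sub>M lborel)"
    unfolding lborel_prod by simp
  then have "emeasure (lborel \<Otimes>\<^sub>M lborel) (kin_cyl r z) = (\<integral>\<^sup>+t. emeasure lborel (Pair t -` kin_cyl r z) \<partial>lborel)"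
    by (rule lborel.emeasure_pair_measure_alt)
  also have "\<dots> = ennreal (?u\<^sup>2 * r ^ (4 * ?n)) * ennreal (r\<^sup>2)"
    unfolding * by (simp add: nn_integral_cmult_indicator)
  also have "\<dots> = ennreal (r ^ (4 * CARD('d) + 2) * cyl_vol TYPE('d))"
    by (simp add: ennreal_mult[symmetric] cyl_vol_def assms power_add power2_eq_square mult_ac)
  finally show ?thesis unfolding lborel_prod .
qed

lemma kin_cyl_lmeasurable [simp]: "r \<ge> 0 \<Longrightarrow> kin_cyl r z \<in> lmeasurable"
  by (rule lmeasurable_iff_integrable[THEN iffD2], rule integrable_real_indicator)
     (auto simp: emeasure_kin_cyl)

lemma measure_kin_cyl:
  fixes z :: "'d::finite phase"
  assumes "r \<ge> 0"
  shows "measure lebesgue (kin_cyl r z) = r ^ (4 * CARD('d) + 2) * cyl_vol TYPE('d)"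
  using emeasure_kin_cyl[OF assms, of z] assms
  by (simp add: measure_def cyl_vol_def)

lemma kin_cyl_mono:
  assumes "0 \<le> r" "r \<le> s" shows "kin_cyl r z \<subseteq> kin_cyl s z"
proof (cases z)
  case (fields t0 x0 v0)
  have "r\<^sup>2 \<le> s\<^sup>2" "r ^ 3 \<le> s ^ 3" using assms by (auto intro: power_mono)
  then show ?thesis unfolding fields using assms(2) by (clarsimp; linarith)
qed

(* Cylinders only extend into the past, so the centre of the engulfing one is carried forward along
   its velocity; the cap T keeps it inside the domain. *)
lemma kin_cyl_engulf:
  fixes u :: "'d::finite phase"
  assumes "0 < \<rho>" "fst u \<le> T"
  obtains u' where "fst u' \<le> T" "\<And>w \<rho>'. \<lbrakk>0 < \<rho>'; \<rho>' \<le> \<rho>; fst w \<le> T; kin_cyl \<rho>' w \<inter> kin_cyl \<rho> u \<noteq> {}\<rbrakk>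
    \<Longrightarrow> kin_cyl \<rho>' w \<subseteq> kin_cyl (3 * \<rho>) u'"
proof (cases u)
  case (fields t0 x0 v0)
  define \<tau> where "\<tau> = min T (t0 + \<rho>\<^sup>2)"
  define u' where "u' = (\<tau>, x0 + (\<tau> - t0) *\<^sub>R v0, v0)"
  show thesis
  proof
    show "fst u' \<le> T" by (simp add: u'_def \<tau>_def)
    fix w :: "'d phase" and \<rho>' assume \<rho>': "0 < \<rho>'" "\<rho>' \<le> \<rho>" "fst w \<le> T" "kin_cyl \<rho>' w \<inter> kin_cyl \<rho> u \<noteq> {}"
    obtain t1 x1 v1 where w: "w = (t1, x1, v1)" by (cases w)
    from \<rho>'(4) obtain t x v where "(t, x, v) \<in> kin_cyl \<rho>' w" "(t, x, v) \<in> kin_cyl \<rho> u" by auto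
    then have y: "- \<rho>'\<^sup>2 < t - t1" "t - t1 \<le> 0" "norm (x - x1 - (t - t1) *\<^sub>R v1) < \<rho>' ^ 3" "norm (v - v1) < \<rho>'"
      "- \<rho>\<^sup>2 < t - t0" "t - t0 \<le> 0" "norm (x - x0 - (t - t0) *\<^sub>R v0) < \<rho> ^ 3" "norm (v - v0) < \<rho>"
      by (auto simp: w fields)
    have pw: "\<rho>'\<^sup>2 \<le> \<rho>\<^sup>2" "\<rho>' ^ 3 \<le> \<rho> ^ 3" using \<rho>' by (auto intro: power_mono)
    show "kin_cyl \<rho>' w \<subseteq> kin_cyl (3 * \<rho>) u'"
    proof (clarify, unfold u'_def w)
      fix t2 x2 v2 assume "(t2, x2, v2) \<in> kin_cyl \<rho>' (t1, x1, v1)"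
      then have z: "- \<rho>'\<^sup>2 < t2 - t1" "t2 - t1 \<le> 0" "norm (x2 - x1 - (t2 - t1) *\<^sub>R v1) < \<rho>' ^ 3" "norm (v2 - v1) < \<rho>'"
        by auto
      have \<tau>: "t1 \<le> \<tau>" "\<tau> \<le> t0 + \<rho>\<^sup>2" using y pw \<rho>'(3) by (auto simp: \<tau>_def w)
      have "- (9 * \<rho>\<^sup>2) < t2 - \<tau>" "t2 - \<tau> \<le> 0" using z y pw \<tau> zero_le_power2[of \<rho>] by linarith+
      moreover have vv: "norm (v1 - v0) < 2 * \<rho>"
        using norm_triangle_ineq[of "v1 - v" "v - v0"] y \<rho>' by (simp add: norm_minus_commute)
      moreover have "norm (v2 - v0) < 3 * \<rho>"
        using norm_triangle_ineq[of "v2 - v1" "v1 - v0"] z vv \<rho>' by simp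
      moreover have "norm (x2 - (x0 + (\<tau> - t0) *\<^sub>R v0) - (t2 - \<tau>) *\<^sub>R v0) < 27 * \<rho> ^ 3"
      proof -
        \<comment> \<open>The new centre moves with velocity \<open>v0\<close>, so \<tau> cancels,
          and the only error beyond the three position radii is the shear (t2 - t)(v1 - v0). In
          total the position uses 5 \<rho>^3 of the available 27 \<rho>^3; the factor 3 is dictated
          by the velocities.\<close>
        have eq: "x2 - (x0 + (\<tau> - t0) *\<^sub>R v0) - (t2 - \<tau>) *\<^sub>R v0 =
            (x2 - x1 - (t2 - t1) *\<^sub>R v1) - (x - x1 - (t - t1) *\<^sub>R v1) + (x - x0 - (t - t0) *\<^sub>R v0) + (t2 - t) *\<^sub>R (v1 - v0)"
          by (simp add: algebra_simps)
        have "norm ((t2 - t) *\<^sub>R (v1 - v0)) \<le> \<rho>\<^sup>2 * (2 * \<rho>)"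
          unfolding norm_scaleR using y z pw vv by (intro mult_mono) auto
        also have "\<dots> = 2 * \<rho> ^ 3" by (simp add: power2_eq_square power3_eq_cube)
        finally have "norm ((t2 - t) *\<^sub>R (v1 - v0)) \<le> 2 * \<rho> ^ 3" .
        moreover have "norm ((x2 - x1 - (t2 - t1) *\<^sub>R v1) - (x - x1 - (t - t1) *\<^sub>R v1)) < 2 * \<rho> ^ 3"
          using norm_triangle_ineq4[of "x2 - x1 - (t2 - t1) *\<^sub>R v1" "x - x1 - (t - t1) *\<^sub>R v1"] y z pw by linarith
        moreover have "0 < \<rho> ^ 3" using assms by simp
        ultimately show ?thesis
          unfolding eq using y
            norm_triangle_ineq[of "(x2 - x1 - (t2 - t1) *\<^sub>R v1) - (x - x1 - (t - t1) *\<^sub>R v1) + (x - x0 - (t - t0) *\<^sub>R v0)" "(t2 - t) *\<^sub>R (v1 - v0)"]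
            norm_triangle_ineq[of "(x2 - x1 - (t2 - t1) *\<^sub>R v1) - (x - x1 - (t - t1) *\<^sub>R v1)" "x - x0 - (t - t0) *\<^sub>R v0"]
          by linarith
      qed
      ultimately show "(t2, x2, v2) \<in> kin_cyl (3 * \<rho>) (\<tau>, x0 + (\<tau> - t0) *\<^sub>R v0, v0)"
        by (simp add: power_mult_distrib)
    qed
  qed
qed

text \<open>The velocity of the centre is below s + R in norm, so drifting for a time R^2 displaces
  positions by at most R^2 (s + R), which is absorbed when (s + 3R)^3 is expanded. The hypothesis
  \<open>fst w \<le> 0\<close> supplies the upper time bound. This keeps cylinders that touch Q_s
  inside Q_r once 3R \<le> r - s.\<close>

lemma kin_cyl_subset_kin_cyl0:
  fixes w :: "'d::finite phase"
  assumes "kin_cyl R w \<inter> kin_cyl0 s \<noteq> {}" "fst w \<le> 0" "0 < R" "0 < s"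
  shows "kin_cyl R w \<subseteq> kin_cyl0 (s + 3 * R)"
proof (cases w)
  case (fields t0 x0 v0)
  from assms(1) obtain t x v where "(t, x, v) \<in> kin_cyl R w" "(t, x, v) \<in> kin_cyl0 s" by auto
  then have y: "- R\<^sup>2 < t - t0" "t - t0 \<le> 0" "norm (x - x0 - (t - t0) *\<^sub>R v0) < R ^ 3" "norm (v - v0) < R"
    "- s\<^sup>2 < t" "norm x < s ^ 3" "norm v < s"
    by (auto simp: fields kin_cyl0_def dist_norm)
  show ?thesis
  proof clarify
    fix t2 x2 v2 assume "(t2, x2, v2) \<in> kin_cyl R w"
    then have z: "- R\<^sup>2 < t2 - t0" "t2 - t0 \<le> 0" "norm (x2 - x0 - (t2 - t0) *\<^sub>R v0) < R ^ 3" "norm (v2 - v0) < R"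
      by (auto simp: fields)
    have v0: "norm v0 < s + R" using norm_triangle_ineq2[of v0 v] y by (simp add: norm_minus_commute)
    have "norm ((t2 - t) *\<^sub>R v0) \<le> R\<^sup>2 * (s + R)"
      unfolding norm_scaleR using v0 y z by (intro mult_mono) auto
    moreover have "x2 = (x2 - x0 - (t2 - t0) *\<^sub>R v0) - (x - x0 - (t - t0) *\<^sub>R v0) + x + (t2 - t) *\<^sub>R v0"
      by (simp add: algebra_simps)
    ultimately have "norm x2 < 2 * R ^ 3 + s ^ 3 + R\<^sup>2 * (s + R)"
      using y z 
        norm_triangle_ineq[of "(x2 - x0 - (t2 - t0) *\<^sub>R v0) - (x - x0 - (t - t0) *\<^sub>R v0) + x" "(t2 - t) *\<^sub>R v0"]
        norm_triangle_ineq[of "(x2 - x0 - (t2 - t0) *\<^sub>R v0) - (x - x0 - (t - t0) *\<^sub>R v0)" x]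
        norm_triangle_ineq4[of "x2 - x0 - (t2 - t0) *\<^sub>R v0" "x - x0 - (t - t0) *\<^sub>R v0"]
      by (smt (verit))
    also have "\<dots> \<le> (s + 3 * R) ^ 3"
    proof -
      have "(s + 3 * R) ^ 3 - (2 * R ^ 3 + s ^ 3 + R\<^sup>2 * (s + R)) = 9 * s\<^sup>2 * R + 26 * s * R\<^sup>2 + 24 * R ^ 3"
        by algebra
      moreover have "\<dots> \<ge> 0" using assms by simp
      ultimately show ?thesis by linarith
    qed
    finally have "norm x2 < (s + 3 * R) ^ 3" .
    moreover have "norm v2 < s + 3 * R"
      using norm_triangle_ineq2[of v2 v0] z v0 assms by linarith
    moreover have "- (s + 3 * R)\<^sup>2 < t2" 
    proof -
      have "(s + 3 * R)\<^sup>2 = s\<^sup>2 + 6 * s * R + 9 * R\<^sup>2" by algebra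
      moreover have "0 \<le> s * R" using assms by simp
      ultimately show ?thesis using y z zero_le_power2[of R] by linarith
    qed
    moreover have "t2 \<le> 0" using z assms by (simp add: fields)
    ultimately show "(t2, x2, v2) \<in> kin_cyl0 (s + 3 * R)"
      by (simp add: kin_cyl0_def dist_norm)
  qed
qed

text \<open>The cylinder contains points of its top face t = t0 and so is not open; making that one
  inequality strict leaves an open subset.\<close>

lemma interior_kin_cyl:
  fixes x0 v0 :: "real ^ 'd"
  assumes "- (r\<^sup>2) < t - t0" "t - t0 < 0" "norm (x - x0 - (t - t0) *\<^sub>R v0) < r ^ 3" "norm (v - v0) < r"
  shows "(t, x, v) \<in> interior (kin_cyl r (t0, x0, v0))"
proof (rule interiorI)
  show "open {z::'d phase. - (r\<^sup>2) < fst z - t0 \<and> fst z - t0 < 0 \<and>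
        norm (fst (snd z) - x0 - (fst z - t0) *\<^sub>R v0) < r ^ 3 \<and> norm (snd (snd z) - v0) < r}"
    by (intro open_Collect_conj open_Collect_less continuous_intros)
qed (use assms in auto)

text \<open>For fixed v the shear over a time R^2 moves positions by O(R^2), so these cylinders
  shrink to points in the Euclidean sense as well.\<close>

lemma small_kin_cyl:
  fixes z :: "'d::finite phase"
  assumes "open U" "z \<in> U"
  obtains R w where "R > 0" "z \<in> interior (kin_cyl R w)" "kin_cyl R w \<subseteq> U"
proof (cases z)
  case (fields t x v)
  obtain e where e: "e > 0" "ball z e \<subseteq> U" using assms open_contains_ball by blast
  have "((\<lambda>R. R\<^sup>2 + (2 * R ^ 3 + R\<^sup>2 * norm v + R)) \<longlongrightarrow> 0\<^sup>2 + (2 * 0 ^ 3 + 0\<^sup>2 * norm v + 0)) (at_right 0)"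
    by (intro tendsto_intros)
  then have "\<forall>\<^sub>F R in at_right (0::real). R\<^sup>2 + (2 * R ^ 3 + R\<^sup>2 * norm v + R) < e"
    using e by (intro order_tendstoD) auto
  then obtain R where R: "R > 0" "R\<^sup>2 + (2 * R ^ 3 + R\<^sup>2 * norm v + R) < e"
    using eventually_at_right_less[of 0] by (metis (mono_tags, lifting) eventually_conj eventually_happens trivial_limit_at_right_real)
  \<comment> \<open>The point z lies on the top face of the cylinder centred at z. The centre is
    therefore carried half a height ahead by free transport, which puts z on the axis at
    mid-height.\<close>
  let ?w = "(t + R\<^sup>2 / 2, x + (R\<^sup>2 / 2) *\<^sub>R v, v)"
  show thesis
  proof
    show "R > 0" by fact
    show "z \<in> interior (kin_cyl R ?w)"
      unfolding fields using R by (intro interior_kin_cyl) auto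
    show "kin_cyl R ?w \<subseteq> U"
    proof (rule order_trans[OF _ e(2)], clarify)
      fix t2 x2 v2 assume "(t2, x2, v2) \<in> kin_cyl R ?w"
      then have y: "- R\<^sup>2 < t2 - t - R\<^sup>2 / 2" "t2 - t - R\<^sup>2 / 2 \<le> 0" "norm (v2 - v) < R"
        "norm (x2 - (x + (R\<^sup>2 / 2) *\<^sub>R v) - (t2 - (t + R\<^sup>2 / 2)) *\<^sub>R v) < R ^ 3"
        by (auto simp: algebra_simps)
      have eq: "x2 - (x + (R\<^sup>2 / 2) *\<^sub>R v) - (t2 - (t + R\<^sup>2 / 2)) *\<^sub>R v = x2 - x - (t2 - t) *\<^sub>R v"
        by (simp add: algebra_simps)
      have t: "\<bar>t2 - t\<bar> < R\<^sup>2" using y R zero_less_power[of R 2] by linarith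
      then have "norm ((t2 - t) *\<^sub>R v) \<le> R\<^sup>2 * norm v" by (simp add: mult_right_mono)
      then have x: "norm (x2 - x) < R ^ 3 + R\<^sup>2 * norm v"
        using y(4) norm_triangle_ineq[of "x2 - x - (t2 - t) *\<^sub>R v" "(t2 - t) *\<^sub>R v"] unfolding eq by simp
      have "norm ((t2, x2, v2) - z) \<le> \<bar>t2 - t\<bar> + (norm (x2 - x) + norm (v2 - v))"
        unfolding fields
        using norm_Pair_le[of "t2 - t" "(x2 - x, v2 - v)"] norm_Pair_le[of "x2 - x" "v2 - v"] by simp
      moreover have "R ^ 3 > 0" using R by simp
      ultimately have "norm ((t2, x2, v2) - z) < e" using t x y R by linarith
      then show "(t2, x2, v2) \<in> ball z e" by (simp add: dist_norm norm_minus_commute)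
    qed
  qed
qed

text \<open>Greedy selection: keep a member of maximal \<open>rad\<close>, drop everything meeting
  it, recurse. \<open>S\<close> and \<open>rad\<close> are not tied to each other; geometry enters
  only when the dropped cylinders are engulfed.\<close>

lemma finite_vitali:
  fixes rad :: "'i \<Rightarrow> real"
  assumes "finite I" "\<And>i. i \<in> I \<Longrightarrow> S i \<noteq> {}"
  obtains J where "J \<subseteq> I" "disjoint_family_on S J" "\<And>i. i \<in> I \<Longrightarrow> \<exists>j\<in>J. rad i \<le> rad j \<and> S i \<inter> S j \<noteq> {}"
proof -
  have "\<exists>J\<subseteq>I. disjoint_family_on S J \<and> (\<forall>i\<in>I. \<exists>j\<in>J. rad i \<le> rad j \<and> S i \<inter> S j \<noteq> {})"
    using assms
  proof (induction "card I" arbitrary: I rule: less_induct)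
    case less
    show ?case
    proof (cases "I = {}")
      case False
      then obtain m where m: "m \<in> I" "\<And>i. i \<in> I \<Longrightarrow> rad i \<le> rad m"
        using \<open>finite I\<close> Max_in[of "rad ` I"] Max_ge[of "rad ` I"] by fastforce
      let ?I = "{i \<in> I. S i \<inter> S m = {}}"
      \<comment> \<open>The recursion shrinks because \<open>S m\<close> is nonempty, so m meets
        itself and leaves \<open>?I\<close>.\<close>
      have "card ?I < card I"
        using m less.prems by (intro psubset_card_mono) auto
      then obtain J where J: "J \<subseteq> ?I" "disjoint_family_on S J"
        "\<forall>i\<in>?I. \<exists>j\<in>J. rad i \<le> rad j \<and> S i \<inter> S j \<noteq> {}"
        using less.hyps[of ?I] less.prems by auto
      then have "disjoint_family_on S (insert m J)"
        unfolding disjoint_family_on_def by blast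
      moreover have "\<forall>i\<in>I. \<exists>j\<in>insert m J. rad i \<le> rad j \<and> S i \<inter> S j \<noteq> {}"
        using J(3) m(2) by blast
      ultimately show ?thesis using J(1) m(1) by (intro exI[of _ "insert m J"]) auto
    qed (auto simp: disjoint_family_on_def)
  qed
  then show thesis using that by blast
qed

section \<open>Covering and differentiation\<close>

lemma set_integral_mono_set:
  fixes f :: "'a \<Rightarrow> real"
  assumes "set_integrable M T f" "S \<in> sets M" "S \<subseteq> T" "\<And>x. x \<in> T \<Longrightarrow> 0 \<le> f x"
  shows "(LINT x:S|M. f x) \<le> (LINT x:T|M. f x)"
  unfolding set_lebesgue_integral_def
proof (rule integral_mono)
  show "integrable M (\<lambda>x. indicator S x *\<^sub>R f x)"
    using set_integrable_subset[OF assms(1-3)] by (simp add: set_integrable_def)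
  show "integrable M (\<lambda>x. indicator T x *\<^sub>R f x)"
    using assms(1) by (simp add: set_integrable_def)
qed (use assms(3,4) in \<open>auto simp: indicator_def\<close>)

lemma set_integral_ge_zero:
  fixes f :: "'a \<Rightarrow> real"
  assumes "\<And>x. x \<in> S \<Longrightarrow> 0 \<le> f x"
  shows "0 \<le> (LINT x:S|M. f x)"
  unfolding set_lebesgue_integral_def
  by (rule integral_nonneg_AE) (use assms in \<open>auto simp: indicator_def\<close>)

lemma set_integral_le_sum_cover:
  fixes f :: "'a \<Rightarrow> real"
  assumes "set_integrable M T f" "\<And>x. x \<in> T \<Longrightarrow> 0 \<le> f x"
    and "finite I" "\<And>i. i \<in> I \<Longrightarrow> S i \<in> sets M" "\<And>i. i \<in> I \<Longrightarrow> S i \<subseteq> T"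
    and "K \<in> sets M" "K \<subseteq> (\<Union>i\<in>I. S i)"
  shows "(LINT x:K|M. f x) \<le> (\<Sum>i\<in>I. LINT x:S i|M. f x)"
proof -
  have i: "integrable M (\<lambda>x. indicator (S i) x *\<^sub>R f x)" if "i \<in> I" for i
    using set_integrable_subset[OF assms(1)] assms that by (simp add: set_integrable_def)
  have iK: "integrable M (\<lambda>x. indicator K x *\<^sub>R f x)"
    using set_integrable_subset[OF assms(1), of K] assms by (force simp: set_integrable_def)
  have "(LINT x:K|M. f x) \<le> (LINT x|M. (\<Sum>i\<in>I. indicator (S i) x *\<^sub>R f x))"
    unfolding set_lebesgue_integral_def
  proof (rule integral_mono[OF iK])
    show "integrable M (\<lambda>x. \<Sum>i\<in>I. indicator (S i) x *\<^sub>R f x)" using i by auto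
    fix x
    have nn: "0 \<le> indicator (S i) x *\<^sub>R f x" if "i \<in> I" for i
      using assms that by (auto simp: indicator_def)
    show "indicator K x *\<^sub>R f x \<le> (\<Sum>i\<in>I. indicator (S i) x *\<^sub>R f x)"
    proof (cases "x \<in> K")
      case True
      then obtain i where "i \<in> I" "x \<in> S i" using assms(7) by auto
      then show ?thesis using member_le_sum[of i I "\<lambda>i. indicator (S i) x *\<^sub>R f x"] nn True assms(3) by auto
    qed (use nn in \<open>auto intro!: sum_nonneg\<close>)
  qed
  also have "\<dots> = (\<Sum>i\<in>I. LINT x:S i|M. f x)"
    unfolding set_lebesgue_integral_def using i by (rule Bochner_Integration.integral_sum)
  finally show ?thesis .
qed

lemma set_integral_disjoint_sum_le:
  fixes f :: "'a \<Rightarrow> real"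
  assumes "set_integrable M T f" "\<And>x. x \<in> T \<Longrightarrow> 0 \<le> f x"
    and "finite I" "disjoint_family_on S I" "\<And>i. i \<in> I \<Longrightarrow> S i \<in> sets M" "\<And>i. i \<in> I \<Longrightarrow> S i \<subseteq> T"
    and "T \<in> sets M"
  shows "(\<Sum>i\<in>I. LINT x:S i|M. f x) \<le> (LINT x:T|M. f x)"
proof -
  have "(\<Sum>i\<in>I. LINT x:S i|M. f x) = (LINT x:(\<Union>i\<in>I. S i)|M. f x)"
    using assms by (intro set_integral_finite_Union[symmetric] set_integrable_subset[OF assms(1)]) auto
  also have "\<dots> \<le> (LINT x:T|M. f x)"
    using assms by (intro set_integral_mono_set) auto
  finally show ?thesis .
qed

text \<open>Inner regularity: up to a null set E is a countable union of compact sets, so not all of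
  these can be null.\<close>

lemma compact_nonnull_subset:
  fixes E :: "'a::euclidean_space set"
  assumes "E \<in> sets lebesgue" "E \<notin> null_sets lebesgue"
  obtains K where "compact K" "K \<subseteq> E" "measure lebesgue K > 0"
proof (rule ccontr)
  assume *: "\<not> thesis"
  then have nothesis: "\<not> measure lebesgue K > 0" if "compact K" "K \<subseteq> E" for K
    using that \<open>\<And>K. \<lbrakk>compact K; K \<subseteq> E; 0 < measure lebesgue K\<rbrakk> \<Longrightarrow> thesis\<close> by blast
  have *: "K \<in> null_sets lebesgue" if "compact K" "K \<subseteq> E" for K
  proof -
    have "measure lebesgue K = 0"
      using nothesis[OF that] by (metis less_eq_real_def measure_nonneg)
    then show ?thesis
      using lmeasurable_compact[OF \<open>compact K\<close>] by (simp add: negligible_iff_measure flip: negligible_iff_null_sets)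
  qed
  obtain C T where CT: "fsigma C" "T \<in> null_sets lebesgue" "C \<union> T = E" "disjnt C T"
    using lebesgue_set_almost_fsigma[OF assms(1)] by metis
  obtain F :: "nat \<Rightarrow> 'a set" where F: "range F \<subseteq> Collect compact" "C = \<Union>(range F)"
    using CT(1) fsigma_Union_compact by metis
  then have "F n \<in> null_sets lebesgue" for n using * CT(3) by auto
  then have "(\<Union>n. F n) \<in> null_sets lebesgue" by (rule null_sets_UN)
  then have "E \<in> null_sets lebesgue" using CT F(2) by auto
  with assms show False by simp
qed

lemma kin_cyl_lebesgue [simp]: "kin_cyl R w \<in> sets lebesgue"
  using kin_cyl_borel by simp

text \<open>Here the time cap never bites: a cylinder of radius at most \<rho> meeting
  \<open>kin_cyl \<rho> u\<close> has its centre no later than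
  \<open>fst u + \<rho>\<^sup>2\<close>, and this value serves as T.\<close>

lemma kin_cyl_engulf_self:
  fixes u :: "'d::finite phase"
  assumes "0 < \<rho>"
  obtains u' where "\<And>w \<rho>'. \<lbrakk>0 < \<rho>'; \<rho>' \<le> \<rho>; kin_cyl \<rho>' w \<inter> kin_cyl \<rho> u \<noteq> {}\<rbrakk>
    \<Longrightarrow> kin_cyl \<rho>' w \<subseteq> kin_cyl (3 * \<rho>) u'"
proof -
  have le: "fst w \<le> fst u + \<rho>\<^sup>2" if "0 < \<rho>'" "\<rho>' \<le> \<rho>" "kin_cyl \<rho>' w \<inter> kin_cyl \<rho> u \<noteq> {}" for w \<rho>'
  proof -
    have "\<rho>'\<^sup>2 \<le> \<rho>\<^sup>2" using that by (intro power_mono) auto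
    with that(3) show ?thesis by (cases w; cases u) fastforce
  qed
  have "fst u \<le> fst u + \<rho>\<^sup>2" by simp
  then obtain u' where "\<And>w \<rho>'. \<lbrakk>0 < \<rho>'; \<rho>' \<le> \<rho>; fst w \<le> fst u + \<rho>\<^sup>2; kin_cyl \<rho>' w \<inter> kin_cyl \<rho> u \<noteq> {}\<rbrakk>
    \<Longrightarrow> kin_cyl \<rho>' w \<subseteq> kin_cyl (3 * \<rho>) u'"
    by (rule kin_cyl_engulf[OF assms]) blast
  with le show thesis by (intro that[of u']) blast
qed

lemma kin_cyl_interior_nonempty: "z \<in> interior (kin_cyl R w) \<Longrightarrow> kin_cyl R w \<noteq> {}"
  using interior_subset by fastforce

text \<open>One-sided Lebesgue differentiation for non-centred kinetic cylinders, by a Vitali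
  argument. If a nonnull part of {f \<ge> \<mu> + \<delta>} avoided the union \<open>G\<close> of
  the interiors of good cylinders, a compact piece K of it could be covered by cylinders inside an
  open set of hardly larger measure. None of them is good, so f has mean at most \<mu> on each; yet
  a disjoint selection of them lies mostly in K, where f \<ge> \<mu> + \<delta>.\<close>

lemma kin_cyl_differentiation:
  fixes f :: "'d::finite phase \<Rightarrow> real"
  assumes "open \<Omega>" and f: "set_integrable lebesgue \<Omega> f" and nn: "\<And>z. z \<in> \<Omega> \<Longrightarrow> 0 \<le> f z" and "\<mu> \<ge> 0"
  shows "AE z in lebesgue. z \<in> \<Omega> \<longrightarrow> f z > \<mu> \<longrightarrow> (\<exists>R>0. \<exists>w. z \<in> interior (kin_cyl R w) \<and>
    kin_cyl R w \<subseteq> \<Omega> \<and> \<mu> * measure lebesgue (kin_cyl R w) < (LINT y:kin_cyl R w|lebesgue. f y))"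
proof -
  define good where "good R w \<longleftrightarrow> R > 0 \<and> kin_cyl R w \<subseteq> \<Omega> \<and>
    \<mu> * measure lebesgue (kin_cyl R w) < (LINT y:kin_cyl R w|lebesgue. f y)" for R w
  define G where "G = \<Union>{interior (kin_cyl R w) | R w. good R w}"
  have "open G" unfolding G_def by auto
  have meas: "{z \<in> \<Omega>. a \<le> f z} \<in> sets lebesgue" for a
  proof -
    have "(\<lambda>z. indicator \<Omega> z * f z) \<in> borel_measurable lebesgue"
      using f by (simp add: set_integrable_def borel_measurable_integrable)
    moreover have "\<Omega> \<in> sets lebesgue" using \<open>open \<Omega>\<close> by simp
    ultimately have "{z \<in> space lebesgue. a \<le> indicator \<Omega> z * f z} \<inter> \<Omega> \<in> sets lebesgue"
      by (intro sets.Int borel_measurable_le) auto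
    also have "{z \<in> space lebesgue. a \<le> indicator \<Omega> z * f z} \<inter> \<Omega> = {z \<in> \<Omega>. a \<le> f z}"
      by (auto simp: indicator_def)
    finally show ?thesis .
  qed
  have null: "{z \<in> \<Omega>. \<mu> + \<delta> \<le> f z} - G \<in> null_sets lebesgue" if "\<delta> > 0" for \<delta>
  proof (rule ccontr)
    let ?E = "{z \<in> \<Omega>. \<mu> + \<delta> \<le> f z} - G"
    assume nonnull: "?E \<notin> null_sets lebesgue"
    have "?E \<in> sets lebesgue"
      by (rule sets.Diff[OF meas]) (use \<open>open G\<close> in simp)
    then obtain K where K: "compact K" "K \<subseteq> ?E" "measure lebesgue K > 0"
      using nonnull by (rule compact_nonnull_subset)
    define c :: real where "c = 3 ^ (4 * CARD('d) + 2)"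
    have "c > 0" by (simp add: c_def)
    \<comment> \<open>Chosen so that (\<mu> + \<delta>) \<epsilon> c = \<delta>/2: the part of the
      selected cylinders outside K then costs only half of the excess \<delta>.\<close>
    define \<epsilon> where "\<epsilon> = \<delta> / (2 * c * (\<mu> + \<delta>))"
    have \<epsilon>: "\<epsilon> > 0" using \<open>c > 0\<close> \<open>\<delta> > 0\<close> \<open>\<mu> \<ge> 0\<close> by (simp add: \<epsilon>_def)
    have "K \<in> sets lebesgue" "K \<in> lmeasurable" using K(1) by (auto simp: compact_imp_closed lmeasurable_compact)
    have "\<epsilon> * measure lebesgue K > 0" using \<epsilon> K(3) by simp
    with \<open>K \<in> sets lebesgue\<close> obtain U where U: "open U" "K \<subseteq> U" "U - K \<in> lmeasurable"
        "emeasure lebesgue (U - K) < ennreal (\<epsilon> * measure lebesgue K)"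
      by (rule sets_lebesgue_outer_open)
    have "\<forall>z\<in>K. \<exists>R w. R > 0 \<and> z \<in> interior (kin_cyl R w) \<and> kin_cyl R w \<subseteq> U \<inter> \<Omega>"
    proof
      fix z assume "z \<in> K"
      then show "\<exists>R w. R > 0 \<and> z \<in> interior (kin_cyl R w) \<and> kin_cyl R w \<subseteq> U \<inter> \<Omega>"
      proof -
        have "open (U \<inter> \<Omega>)" using U(1) \<open>open \<Omega>\<close> by (rule open_Int)
        moreover have "z \<in> U \<inter> \<Omega>" using \<open>z \<in> K\<close> U(2) K(2) by auto
        ultimately obtain R w where "R > 0" "z \<in> interior (kin_cyl R w)" "kin_cyl R w \<subseteq> U \<inter> \<Omega>"
          by (rule small_kin_cyl)
        then show ?thesis by (intro exI conjI)
      qed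
    qed
    then obtain R w where Rw: "\<And>z. z \<in> K \<Longrightarrow> (R z::real) > 0 \<and> z \<in> interior (kin_cyl (R z) (w z)) \<and> kin_cyl (R z) (w z) \<subseteq> U \<inter> \<Omega>"
      unfolding bchoice_iff by blast
    let ?Q = "\<lambda>z. kin_cyl (R z) (w z)"
    obtain I where I: "I \<subseteq> K" "finite I" "K \<subseteq> (\<Union>z\<in>I. interior (?Q z))"
    proof (rule compactE_image[OF K(1), of K "\<lambda>z. interior (?Q z)"])
      show "K \<subseteq> (\<Union>z\<in>K. interior (?Q z))" using Rw by blast
    qed (auto simp del: kin_cyl.simps)
    have nbad: "\<not> good (R z) (w z)" if "z \<in> I" for z
      using K(2) I(1) Rw[of z] that unfolding G_def by blast
    obtain J where J: "J \<subseteq> I" "disjoint_family_on ?Q J" "\<And>i. i \<in> I \<Longrightarrow> \<exists>j\<in>J. R i \<le> R j \<and> ?Q i \<inter> ?Q j \<noteq> {}"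
    proof (rule finite_vitali[of I ?Q R])
      show "?Q i \<noteq> {}" if "i \<in> I" for i
        using Rw[of i] that I(1) kin_cyl_interior_nonempty by blast
    qed (use I(2) in blast)+
    have "finite J" using J I finite_subset by blast
    have JK: "j \<in> K" if "j \<in> J" for j using that J I by auto
    define S where "S = (\<Sum>j\<in>J. measure lebesgue (?Q j))"
    have "\<exists>u. \<forall>i\<in>I. R i \<le> R j \<longrightarrow> ?Q i \<inter> ?Q j \<noteq> {} \<longrightarrow> ?Q i \<subseteq> kin_cyl (3 * R j) u" if "j \<in> J" for j
      by (rule kin_cyl_engulf_self[of "R j" "w j"]) (use Rw JK[OF that] I(1) in \<open>blast+\<close>)
    then obtain u where u: "\<And>i j. \<lbrakk>j \<in> J; i \<in> I; R i \<le> R j; ?Q i \<inter> ?Q j \<noteq> {}\<rbrakk> \<Longrightarrow> ?Q i \<subseteq> kin_cyl (3 * R j) (u j)"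
      by metis
    have cover: "K \<subseteq> (\<Union>j\<in>J. kin_cyl (3 * R j) (u j))"
    proof
      fix z assume "z \<in> K"
      then obtain i where i: "i \<in> I" "z \<in> ?Q i" using I(3) interior_subset by blast
      then show "z \<in> (\<Union>j\<in>J. kin_cyl (3 * R j) (u j))" using J(3)[OF i(1)] u[OF _ i(1)] by blast
    qed
    have "measure lebesgue K \<le> measure lebesgue (\<Union>j\<in>J. kin_cyl (3 * R j) (u j))"
      using cover \<open>finite J\<close> \<open>K \<in> sets lebesgue\<close> Rw JK
      by (intro measure_mono_fmeasurable fmeasurable.finite_UN) (auto intro!: kin_cyl_lmeasurable simp: less_imp_le)
    also have "\<dots> \<le> (\<Sum>j\<in>J. measure lebesgue (kin_cyl (3 * R j) (u j)))"
      using \<open>finite J\<close> Rw JK by (intro measure_UNION_le) auto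
    also have "\<dots> = c * S"
      unfolding S_def sum_distrib_left
    proof (rule sum.cong[OF refl])
      fix j assume "j \<in> J"
      then have "0 \<le> R j" using Rw JK by (simp add: less_imp_le)
      then show "measure lebesgue (kin_cyl (3 * R j) (u j)) = c * measure lebesgue (?Q j)"
        by (subst (1 2) measure_kin_cyl) (simp_all add: c_def power_mult_distrib)
    qed
    finally have KS: "measure lebesgue K \<le> c * S" .
    then have "S > 0" using K(3) \<open>c > 0\<close> by (metis less_le_trans zero_less_mult_pos)
    let ?V = "\<Union>j\<in>J. ?Q j"
    have Vm: "?V \<in> lmeasurable"
      using \<open>finite J\<close> Rw JK by (intro fmeasurable.finite_UN) (auto simp: less_imp_le)
    have VU: "?V \<subseteq> U \<inter> \<Omega>" using Rw JK by blast
    have fin: "measure lebesgue ?V = S"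
      unfolding S_def using \<open>finite J\<close> J(2) Rw JK
      by (intro measure_UNION'[symmetric, THEN sym]) (auto simp: less_imp_le disjoint_family_on_def pairwise_def disjnt_def)
    have "measure lebesgue (?V - K) \<le> measure lebesgue (U - K)"
      using VU Vm \<open>K \<in> sets lebesgue\<close> U(3) by (intro measure_mono_fmeasurable) auto
    also have "\<dots> < \<epsilon> * measure lebesgue K"
      using U(4) U(3) by (simp add: emeasure_eq_measure2 ennreal_less_iff)
    also have "\<dots> \<le> \<epsilon> * (c * S)" using KS \<epsilon> by simp
    finally have "measure lebesgue (?V - K) < \<epsilon> * (c * S)" .
    moreover have "measure lebesgue ?V = measure lebesgue (?V \<inter> K) + measure lebesgue (?V - K)"
    proof -
      have "?V \<inter> K \<in> lmeasurable" using Vm \<open>K \<in> lmeasurable\<close> by (rule fmeasurable.Int)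
      from measure_Un2[OF this Vm] show ?thesis
        by (simp only: Un_absorb1[OF Int_lower1] Diff_Int Diff_cancel Un_empty_left)
    qed
    ultimately have "S - \<epsilon> * (c * S) < measure lebesgue (?V \<inter> K)" using fin by linarith
    then have "(\<mu> + \<delta>) * (S - \<epsilon> * (c * S)) < (\<mu> + \<delta>) * measure lebesgue (?V \<inter> K)"
      using \<open>\<delta> > 0\<close> \<open>\<mu> \<ge> 0\<close> by simp
    also have "\<dots> = (LINT z:?V \<inter> K|lebesgue. \<mu> + \<delta>)"
    proof -
      have "?V \<inter> K \<in> lmeasurable" using Vm \<open>K \<in> lmeasurable\<close> by (rule fmeasurable.Int)
      then have "?V \<inter> K \<in> sets lebesgue" "emeasure lebesgue (?V \<inter> K) \<noteq> \<infinity>"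
        unfolding fmeasurable_def by auto
      then show ?thesis by (subst set_integral_const) (auto simp only: real_scaleR_def mult.commute)
    qed
    also have "\<dots> \<le> (LINT z:?V \<inter> K|lebesgue. f z)"
    proof (rule set_integral_mono)
      have "?V \<inter> K \<in> lmeasurable" using Vm \<open>K \<in> lmeasurable\<close> by auto
      then show "set_integrable lebesgue (?V \<inter> K) (\<lambda>z. \<mu> + \<delta>)" by (simp add: set_integrable_def lmeasurable_iff_integrable)
      show "set_integrable lebesgue (?V \<inter> K) f"
        by (rule set_integrable_subset[OF f]) (use VU Vm \<open>K \<in> sets lebesgue\<close> in auto)
    qed (use K in auto)
    also have "\<dots> \<le> (\<Sum>j\<in>J. LINT z:?Q j|lebesgue. f z)"
      by (rule set_integral_le_sum_cover[OF f nn \<open>finite J\<close>]) (use VU Vm \<open>K \<in> sets lebesgue\<close> in auto)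
    also have "\<dots> \<le> (\<Sum>j\<in>J. \<mu> * measure lebesgue (?Q j))"
    proof (rule sum_mono)
      fix j assume "j \<in> J"
      then have "\<not> good (R j) (w j)" "R j > 0" "?Q j \<subseteq> \<Omega>"
        using nbad[of j] subsetD[OF J(1), of j] Rw[OF JK, of j] by blast+
      then show "(LINT z:?Q j|lebesgue. f z) \<le> \<mu> * measure lebesgue (?Q j)"
        unfolding good_def by argo
    qed
    also have "\<dots> = \<mu> * S" by (simp add: S_def sum_distrib_left)
    finally have "(\<mu> + \<delta>) * (S - \<epsilon> * (c * S)) < \<mu> * S" .
    moreover have "(\<mu> + \<delta>) * (S - \<epsilon> * (c * S)) = (\<mu> + \<delta> - (\<mu> + \<delta>) * (\<epsilon> * c)) * S" by algebra
    moreover have "(\<mu> + \<delta>) * (\<epsilon> * c) = \<delta> / 2"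
    proof -
      have "m * (\<delta> / (2 * c * m) * c) = \<delta> / 2" if "m > 0" for m
        using \<open>c > 0\<close> that by (simp add: field_simps)
      from this[of "\<mu> + \<delta>"] show ?thesis
        unfolding \<epsilon>_def using \<open>\<delta> > 0\<close> \<open>\<mu> \<ge> 0\<close> by simp
    qed
    ultimately show False using \<open>S > 0\<close> \<open>\<delta> > 0\<close> by (simp add: mult_less_cancel_right)
  qed
  have "(\<Union>n. {z \<in> \<Omega>. \<mu> + inverse (real (Suc n)) \<le> f z} - G) \<in> null_sets lebesgue"
    by (intro null_sets_UN null) simp
  then show ?thesis
  proof (rule AE_I')
    show "{z \<in> space lebesgue. \<not> (z \<in> \<Omega> \<longrightarrow> f z > \<mu> \<longrightarrow> (\<exists>R>0. \<exists>w. z \<in> interior (kin_cyl R w) \<and>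
      kin_cyl R w \<subseteq> \<Omega> \<and> \<mu> * measure lebesgue (kin_cyl R w) < (LINT y:kin_cyl R w|lebesgue. f y)))}
      \<subseteq> (\<Union>n. {z \<in> \<Omega>. \<mu> + inverse (real (Suc n)) \<le> f z} - G)"
    proof (rule subsetI)
      fix z assume "z \<in> {z \<in> space lebesgue. \<not> (z \<in> \<Omega> \<longrightarrow> f z > \<mu> \<longrightarrow> (\<exists>R>0. \<exists>w. z \<in> interior (kin_cyl R w) \<and>
        kin_cyl R w \<subseteq> \<Omega> \<and> \<mu> * measure lebesgue (kin_cyl R w) < (LINT y:kin_cyl R w|lebesgue. f y)))}"
      then have z: "z \<in> \<Omega>" "\<mu> < f z" "\<not> (\<exists>R>0. \<exists>w. z \<in> interior (kin_cyl R w) \<and>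
        kin_cyl R w \<subseteq> \<Omega> \<and> \<mu> * measure lebesgue (kin_cyl R w) < (LINT y:kin_cyl R w|lebesgue. f y))"
        by simp_all
      obtain n where "inverse (real (Suc n)) < f z - \<mu>"
        using reals_Archimedean[of "f z - \<mu>"] z(2) by auto
      moreover have "z \<notin> G" using z(3) unfolding G_def good_def by blast
      ultimately show "z \<in> (\<Union>n. {z \<in> \<Omega>. \<mu> + inverse (real (Suc n)) \<le> f z} - G)"
        using z(1) by (intro UN_I[of n]) auto
    qed
  qed
qed

section \<open>Stopping cylinders and level sets\<close>

declare kin_cyl.simps [simp del]

definition upper_part :: "real \<Rightarrow> ('a \<Rightarrow> real) \<Rightarrow> 'a \<Rightarrow> real" where
  "upper_part c f x = (if f x > c then f x else 0)"

lemma upper_part_nonneg: "c \<ge> 0 \<Longrightarrow> 0 \<le> upper_part c f x"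
  by (simp add: upper_part_def)

lemma set_integrable_upper_part:
  assumes "set_integrable M T f" "c \<ge> 0"
  shows "set_integrable M T (upper_part c f)"
  unfolding set_integrable_def
proof (rule Bochner_Integration.integrable_bound)
  have m: "(\<lambda>x. indicator T x *\<^sub>R f x) \<in> borel_measurable M"
    using assms by (simp add: set_integrable_def borel_measurable_integrable)
  have "(\<lambda>x. if c < indicator T x *\<^sub>R f x then indicator T x *\<^sub>R f x else 0) \<in> borel_measurable M"
    by (intro measurable_If m borel_measurable_const borel_measurable_less)
  also have "(\<lambda>x. if c < indicator T x *\<^sub>R f x then indicator T x *\<^sub>R f x else 0) = (\<lambda>x. indicator T x *\<^sub>R upper_part c f x)"
    using assms(2) by (auto simp: upper_part_def indicator_def fun_eq_iff)
  finally show "(\<lambda>x. indicator T x *\<^sub>R upper_part c f x) \<in> borel_measurable M" .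
  show "integrable M (\<lambda>x. indicator T x *\<^sub>R f x)"
    using assms by (simp add: set_integrable_def)
qed (auto simp: upper_part_def indicator_def)

text \<open>Values up to c contribute at most c |S|. With c equal to half of a lower bound for the
  mean of f, the values above c must carry the other half; this turns a bound on a mean into a bound
  by an integral over a superlevel set.\<close>

lemma set_integral_le_upper_part:
  fixes f :: "'a \<Rightarrow> real"
  assumes "set_integrable M S f" "c \<ge> 0" "S \<in> fmeasurable M"
  shows "(LINT x:S|M. f x) \<le> (LINT x:S|M. upper_part c f x) + c * measure M S"
proof -
  have i: "integrable M (\<lambda>x. c * indicator S x)"
    using assms(3) by (intro integrable_mult_right integrable_real_indicator) (auto simp: fmeasurable_def)
  have u: "integrable M (\<lambda>x. indicator S x *\<^sub>R upper_part c f x)"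
    using set_integrable_upper_part[OF assms(1,2)] by (simp add: set_integrable_def)
  have "(LINT x:S|M. f x) \<le> (LINT x|M. indicator S x *\<^sub>R upper_part c f x + c * indicator S x)"
    unfolding set_lebesgue_integral_def
    using assms(1,2) i u
    by (intro integral_mono Bochner_Integration.integrable_add)
       (auto simp: set_integrable_def upper_part_def indicator_def)
  also have "\<dots> = (LINT x:S|M. upper_part c f x) + c * measure M S"
    using assms(3) i u by (simp add: set_lebesgue_integral_def Bochner_Integration.integral_add fmeasurable_def sets.Int_space_eq2)
  finally show ?thesis .
qed

lemma mean_eq_set_integral:
  assumes "S \<in> sets lebesgue"
  shows "mean S f = (LINT z:S|lebesgue. f z) / measure lebesgue S"
  using assms by (simp add: mean_def set_lebesgue_integral_def integral_restrict_space)

lemma kin_cyl0_lmeasurable [simp]: "r \<ge> 0 \<Longrightarrow> kin_cyl0 r \<in> lmeasurable"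
  unfolding kin_cyl_origin[symmetric] by (rule kin_cyl_lmeasurable)

lemma kin_cyl0_lebesgue [simp]: "kin_cyl0 r \<in> sets lebesgue"
  unfolding kin_cyl_origin[symmetric] by (rule kin_cyl_lebesgue)

lemma kin_cyl0_mono: "0 \<le> r \<Longrightarrow> r \<le> s \<Longrightarrow> kin_cyl0 r \<subseteq> kin_cyl0 s"
  unfolding kin_cyl_origin[symmetric] by (rule kin_cyl_mono)

lemma center_in_kin_cyl: "R > 0 \<Longrightarrow> z \<in> kin_cyl R z"
  by (cases z) (auto simp: kin_cyl.simps)

lemma fst_kin_cyl0: "z \<in> kin_cyl0 r \<Longrightarrow> fst z \<le> 0"
  by (auto simp: kin_cyl0_def)

text \<open>The data of a single pair g, h. Constants that have to be uniform in the pair are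
  supplied from outside. The bound \<open>\<theta> < 1/2\<close> lets half of lam^q absorb the
  \<theta>-term. Integrability of g is listed next to that of g^q because superlevel integrals of g
  occur to the first power.\<close>

locale reverse_hoelder =
  fixes \<gamma> q b \<theta> :: real and g h :: "'d::finite phase \<Rightarrow> real"
  assumes gamma: "\<gamma> > 1" and q: "q > 1" and b: "b > 1" and theta: "0 < \<theta>" "\<theta> < 1/2"
    and g_nonneg: "\<And>z. z \<in> kin_cyl0 \<gamma> \<Longrightarrow> 0 \<le> g z" and h_nonneg: "\<And>z. z \<in> kin_cyl0 \<gamma> \<Longrightarrow> 0 \<le> h z"
    and g_int: "set_integrable lebesgue (kin_cyl0 \<gamma>) g"
    and gq_int: "set_integrable lebesgue (kin_cyl0 \<gamma>) (\<lambda>z. g z powr q)"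
    and hq_int: "set_integrable lebesgue (kin_cyl0 \<gamma>) (\<lambda>z. h z powr q)"
    and reverse: "\<And>R z0. \<lbrakk>R > 0; z0 \<in> kin_cyl0 \<gamma>; kin_cyl (\<gamma> * R) z0 \<subseteq> kin_cyl0 \<gamma>\<rbrakk> \<Longrightarrow>
       mean (kin_cyl R z0) (\<lambda>z. g z powr q)
         \<le> b * (mean (kin_cyl (\<gamma> * R) z0) g powr q + mean (kin_cyl (\<gamma> * R) z0) (\<lambda>z. h z powr q))
           + \<theta> * mean (kin_cyl (\<gamma> * R) z0) (\<lambda>z. g z powr q)"
begin

abbreviation total :: real where "total \<equiv> (LINT z:kin_cyl0 \<gamma>|lebesgue. g z powr q)"

text \<open>The 4 arises because half of lam^q goes to the \<theta>-term and the other half is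
  shared between g and h. The 2 places the cut lam / \<open>c_g\<close> at half of the lower bound
  for the mean of g.\<close>

definition c_g :: real where "c_g = 2 * (4 * b) powr (1 / q)"

lemma c_g_pos: "c_g > 0"
  using b by (simp add: c_g_def)

text \<open>The reverse Hoelder inequality enters here: \<open>lo\<close> makes its left side exceed
  lam^q and \<open>up\<close> caps the \<theta>-term. The conclusion controls lam^q times the volume
  of the dilate, rather than an integral of g^q, because up to a factor 3^n this product also
  dominates the integral over the engulfing cylinder.\<close>

lemma stopping_estimate:
  fixes z0 :: "'d phase"
  assumes "R > 0" "lam > 0" "kin_cyl (\<gamma> * R) z0 \<subseteq> kin_cyl0 \<gamma>"
    and lo: "lam powr q * measure lebesgue (kin_cyl R z0) < (LINT z:kin_cyl R z0|lebesgue. g z powr q)"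
    and up: "(LINT z:kin_cyl (\<gamma> * R) z0|lebesgue. g z powr q) \<le> lam powr q * measure lebesgue (kin_cyl (\<gamma> * R) z0)"
  shows "lam powr q * measure lebesgue (kin_cyl (\<gamma> * R) z0)
    \<le> c_g * lam powr (q - 1) * (LINT z:kin_cyl (\<gamma> * R) z0|lebesgue. upper_part (lam / c_g) g z)
      + 8 * b * (LINT z:kin_cyl (\<gamma> * R) z0|lebesgue. upper_part (lam powr q / (8 * b)) (\<lambda>z. h z powr q) z)"
proof -
  let ?Q = "kin_cyl (\<gamma> * R) z0" and ?a = "lam powr q"
  let ?m = "measure lebesgue ?Q"
  let ?G = "mean ?Q g" and ?H = "mean ?Q (\<lambda>z. h z powr q)"
  let ?g = "LINT z:?Q|lebesgue. upper_part (lam / c_g) g z"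
  let ?h = "LINT z:?Q|lebesgue. upper_part (?a / (8 * b)) (\<lambda>z. h z powr q) z"
  have Q: "?Q \<in> lmeasurable" using assms(1) gamma by simp
  have Qs: "?Q \<in> sets lebesgue" by simp
  have m: "?m > 0" "measure lebesgue (kin_cyl R z0) > 0"
    using assms(1) gamma cyl_vol_pos[where 'd='d] by (simp_all only: measure_kin_cyl mult_nonneg_nonneg less_imp_le) simp_all
  have gi: "set_integrable lebesgue ?Q g" "set_integrable lebesgue ?Q (\<lambda>z. h z powr q)"
    by (rule set_integrable_subset[OF _ Qs assms(3)], rule g_int hq_int)+
  have nng: "?g \<ge> 0" "?h \<ge> 0"
    using b c_g_pos assms(2) by (auto intro!: set_integral_ge_zero upper_part_nonneg)
  have z0: "z0 \<in> kin_cyl0 \<gamma>"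
    using center_in_kin_cyl[of "\<gamma> * R" z0] assms gamma by auto
  have "?a < mean (kin_cyl R z0) (\<lambda>z. g z powr q)"
    using lo m by (simp add: mean_eq_set_integral pos_less_divide_eq)
  also have "\<dots> \<le> b * (?G powr q + ?H) + \<theta> * mean ?Q (\<lambda>z. g z powr q)"
    by (rule reverse[OF assms(1) z0 assms(3)])
  also have "\<theta> * mean ?Q (\<lambda>z. g z powr q) \<le> (1/2) * ?a"
  proof (rule mult_mono)
    show "mean ?Q (\<lambda>z. g z powr q) \<le> ?a"
      using up m by (simp add: mean_eq_set_integral pos_divide_le_eq)
    show "0 \<le> mean ?Q (\<lambda>z. g z powr q)"
      using m by (simp add: mean_eq_set_integral set_integral_ge_zero)
  qed (use theta in auto)
  finally have key: "?a / 2 < b * (?G powr q) + b * ?H" by (simp add: distrib_left)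
  show ?thesis
  proof (cases "b * (?G powr q) > ?a / 4")
    case True
    then have G: "?a / (4 * b) < ?G powr q" using b by (simp add: field_simps)
    have "?G \<ge> 0"
      using m g_nonneg assms(3) unfolding mean_eq_set_integral[OF Qs]
      by (intro divide_nonneg_pos set_integral_ge_zero) auto
    have "2 * (lam / c_g) = (?a / (4 * b)) powr (1 / q)"
      using assms(2) b q by (simp add: c_g_def powr_divide powr_powr)
    also have "\<dots> \<le> (?G powr q) powr (1 / q)"
      using G b q by (intro powr_mono2) auto
    also have "\<dots> = ?G" using \<open>?G \<ge> 0\<close> q by (simp add: powr_powr)
    finally have "2 * (lam / c_g) * ?m \<le> (LINT z:?Q|lebesgue. g z)"
      using m by (simp add: mean_eq_set_integral pos_le_divide_eq)
    also have "\<dots> \<le> ?g + lam / c_g * ?m"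
      using gi Q c_g_pos assms(2) by (intro set_integral_le_upper_part) auto
    finally have *: "2 * (lam / c_g * ?m) \<le> ?g + lam / c_g * ?m" unfolding mult.assoc .
    have "2 * x \<le> y + x \<Longrightarrow> x \<le> y" for x y :: real by simp
    from this[OF *] have "lam / c_g * ?m \<le> ?g" .
    then have "c_g * lam powr (q - 1) * (lam / c_g * ?m) \<le> c_g * lam powr (q - 1) * ?g"
      using c_g_pos by (intro mult_left_mono) auto
    moreover have "c_g * lam powr (q - 1) * (lam / c_g * ?m) = lam powr (q - 1) * lam powr 1 * ?m"
      using c_g_pos assms(2) by simp
    moreover have "lam powr (q - 1) * lam powr 1 = ?a" unfolding powr_add[symmetric] by simp
    ultimately have "?a * ?m \<le> c_g * lam powr (q - 1) * ?g" by simp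
    moreover have "0 \<le> 8 * b * ?h" using nng b by simp
    ultimately show ?thesis by (rule add_increasing2[rotated])
  next
    case False
    \<comment> \<open>The g-part took at most a quarter of lam^q, so the h-part has the other
      quarter. The cut \<open>?a / (8 * b)\<close> is half of the resulting bound for the mean of
      h^q.\<close>
    then have "?a / (4 * b) < ?H" using b key by (simp add: field_simps)
    then have "?a / (4 * b) * ?m < (LINT z:?Q|lebesgue. h z powr q)"
      using m by (simp add: mean_eq_set_integral pos_less_divide_eq)
    also have "\<dots> \<le> ?h + ?a / (8 * b) * ?m"
      using gi Q b by (intro set_integral_le_upper_part) auto
    finally have "?a * ?m \<le> 8 * b * ?h" using b by (simp add: field_simps)
    moreover have "0 \<le> c_g * lam powr (q - 1) * ?g" using c_g_pos nng by simp
    ultimately show ?thesis by (rule add_increasing[rotated])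
  qed
qed

text \<open>Compactness lets finitely many dilates cover K, so the finite selection suffices.
  \<open>stop\<close> gives each point an admissible cylinder, hence a nonempty set of radii, and
  \<open>big\<close> bounds that set, so that its supremum makes sense.\<close>

lemma level_estimate_compact:
  assumes sr: "1 \<le> s" "s < r" "r \<le> \<gamma>" and lam: "lam > 0"
    and big: "(9 * \<gamma>) ^ (4 * CARD('d) + 2) * total \<le> lam powr q * cyl_vol TYPE('d) * (r - s) ^ (4 * CARD('d) + 2)"
    and K: "compact K" "K \<subseteq> kin_cyl0 s"
    and stop: "\<And>z. z \<in> K \<Longrightarrow> \<exists>R>0. \<exists>w. z \<in> interior (kin_cyl R w) \<and> kin_cyl R w \<subseteq> kin_cyl0 r \<and>
      lam powr q * measure lebesgue (kin_cyl R w) < (LINT y:kin_cyl R w|lebesgue. g y powr q)"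
  shows "(LINT z:K|lebesgue. g z powr q) \<le> 3 ^ (4 * CARD('d) + 2) *
     (c_g * lam powr (q - 1) * (LINT z:kin_cyl0 r|lebesgue. upper_part (lam / c_g) g z)
      + 8 * b * (LINT z:kin_cyl0 r|lebesgue. upper_part (lam powr q / (8 * b)) (\<lambda>z. h z powr q) z))"
proof -
  let ?D = "kin_cyl0 r :: 'd phase set" and ?a = "lam powr q"
  have DD: "?D \<subseteq> kin_cyl0 \<gamma>" using sr by (intro kin_cyl0_mono) auto
  have int: "set_integrable lebesgue ?D g" "set_integrable lebesgue ?D (\<lambda>z. g z powr q)" "set_integrable lebesgue ?D (\<lambda>z. h z powr q)"
    by (rule set_integrable_subset[OF _ kin_cyl0_lebesgue DD], rule g_int gq_int hq_int)+
  have ap: "?a > 0" using lam by simp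
  define adm where "adm R w \<longleftrightarrow> R > 0 \<and> kin_cyl R w \<subseteq> ?D \<and>
      ?a * measure lebesgue (kin_cyl R w) < (LINT y:kin_cyl R w|lebesgue. g y powr q)" for R w
  \<comment> \<open>Admissibility gives lam^q |cylinder| < \<open>total\<close>, and
    \<open>big\<close> turns this into a bound on R. The 9 is 3 times 3: the tripling in the
    engulfing step, then the loss of three radii in \<open>kin_cyl_subset_kin_cyl0\<close>.\<close>
  have small: "9 * (\<gamma> * R) < r - s" if "adm R w" for R w
  proof -
    have R: "R > 0" "kin_cyl R w \<subseteq> kin_cyl0 \<gamma>" "?a * measure lebesgue (kin_cyl R w) < (LINT y:kin_cyl R w|lebesgue. g y powr q)"
      using that DD unfolding adm_def by blast+
    note R(3)
    also have "(LINT y:kin_cyl R w|lebesgue. g y powr q) \<le> total"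
      using R(2) by (intro set_integral_mono_set[OF gq_int]) auto
    finally have "?a * (R ^ (4 * CARD('d) + 2) * cyl_vol TYPE('d)) < total"
      using R(1) by (simp only: measure_kin_cyl less_imp_le)
    then have "(9 * \<gamma>) ^ (4 * CARD('d) + 2) * (?a * (R ^ (4 * CARD('d) + 2) * cyl_vol TYPE('d))) < (9 * \<gamma>) ^ (4 * CARD('d) + 2) * total"
      using gamma by (intro mult_strict_left_mono) auto
    also note big
    finally have "(?a * cyl_vol TYPE('d)) * (9 * (\<gamma> * R)) ^ (4 * CARD('d) + 2) < (?a * cyl_vol TYPE('d)) * (r - s) ^ (4 * CARD('d) + 2)"
      by (simp only: power_mult_distrib mult_ac)
    then have "(9 * (\<gamma> * R)) ^ (4 * CARD('d) + 2) < (r - s) ^ (4 * CARD('d) + 2)"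
      using ap cyl_vol_pos[where 'd='d] by (subst (asm) mult_less_cancel_left_pos) auto
    then show ?thesis by (rule power_less_imp_less_base) (use sr in simp)
  qed
  (* R z is within the factor \<gamma>' of the supremum, so the \<gamma>-dilate is no longer admissible. *)
  define \<gamma>' where "\<gamma>' = min \<gamma> 2"
  have \<gamma>': "\<gamma>' > 1" "\<gamma>' \<le> \<gamma>" "\<gamma>' \<le> 2" using gamma by (auto simp: \<gamma>'_def)
  have "\<forall>z\<in>K. \<exists>R w. adm R w \<and> z \<in> interior (kin_cyl R w) \<and>
      (\<forall>R' w'. adm R' w' \<longrightarrow> z \<in> interior (kin_cyl R' w') \<longrightarrow> R' < \<gamma>' * R)"
  proof
    fix z assume z: "z \<in> K"
    define X where "X = {R. \<exists>w. adm R w \<and> z \<in> interior (kin_cyl R w)}"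
    obtain R0 where R0: "R0 \<in> X" using stop[OF z] unfolding X_def adm_def by blast
    have bdd: "bdd_above X"
    proof (rule bdd_aboveI[of _ "(r - s) / (9 * \<gamma>)"])
      fix R assume "R \<in> X"
      then obtain w where "adm R w" unfolding X_def by blast
      from small[OF this] show "R \<le> (r - s) / (9 * \<gamma>)" using gamma by (simp add: field_simps)
    qed
    have "0 < R0" using R0 unfolding X_def adm_def by blast
    then have "Sup X > 0" using cSup_upper[OF R0 bdd] by linarith
    then have "Sup X / \<gamma>' < Sup X" using \<gamma>' by (simp add: field_simps)
    then obtain R where R: "R \<in> X" "Sup X / \<gamma>' < R"
      using less_cSupD[of X "Sup X / \<gamma>'"] R0 by blast
    then obtain w where w: "adm R w" "z \<in> interior (kin_cyl R w)" unfolding X_def by blast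
    have "R' < \<gamma>' * R" if "adm R' w'" "z \<in> interior (kin_cyl R' w')" for R' w'
    proof -
      have "R' \<in> X" using that unfolding X_def by blast
      then have "R' \<le> Sup X" using bdd by (rule cSup_upper)
      also have "\<dots> < \<gamma>' * R" using R(2) \<gamma>' by (simp add: field_simps)
      finally show ?thesis .
    qed
    with w show "\<exists>R w. adm R w \<and> z \<in> interior (kin_cyl R w) \<and>
      (\<forall>R' w'. adm R' w' \<longrightarrow> z \<in> interior (kin_cyl R' w') \<longrightarrow> R' < \<gamma>' * R)" by blast
  qed
  then obtain R w where Rw: "\<And>z. z \<in> K \<Longrightarrow> adm (R z) (w z) \<and> z \<in> interior (kin_cyl (R z) (w z)) \<and>
      (\<forall>R' w'. adm R' w' \<longrightarrow> z \<in> interior (kin_cyl R' w') \<longrightarrow> R' < \<gamma>' * R z)"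
    unfolding bchoice_iff by blast
  define \<rho> where "\<rho> z = \<gamma> * R z" for z
  define Q where "Q z = kin_cyl (\<rho> z) (w z)" for z
  have Rpos: "R z > 0" and Rsub: "kin_cyl (R z) (w z) \<subseteq> ?D"
    and Rlow: "?a * measure lebesgue (kin_cyl (R z) (w z)) < (LINT y:kin_cyl (R z) (w z)|lebesgue. g y powr q)"
    if "z \<in> K" for z using Rw[OF that] unfolding adm_def by blast+
  have Rsmall: "9 * \<rho> z < r - s" if "z \<in> K" for z
    unfolding \<rho>_def using Rw[OF that] by (intro small[of "R z" "w z"]) blast
  have Rin: "z \<in> interior (kin_cyl (R z) (w z))" if "z \<in> K" for z
    using Rw[OF that] by blast
  have Rmax: "R' < \<gamma>' * R z" if "z \<in> K" "adm R' w'" "z \<in> interior (kin_cyl R' w')" for z R' w'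
    using Rw[OF that(1)] that(2,3) by blast
  have rho: "\<rho> z > 0" "R z \<le> \<rho> z" "\<gamma>' * R z \<le> \<rho> z" if "z \<in> K" for z
    using Rpos[OF that] gamma \<gamma>' unfolding \<rho>_def by auto
  \<comment> \<open>Contrapositive of maximality. It is applied at each selected point both to the
    dilate \<open>Q\<close> and to the engulfing cylinder \<open>E\<close>.\<close>
  have large: "(LINT y:kin_cyl R' w'|lebesgue. g y powr q) \<le> ?a * measure lebesgue (kin_cyl R' w')"
    if "z \<in> K" "\<gamma>' * R z \<le> R'" "z \<in> interior (kin_cyl R' w')" "kin_cyl R' w' \<subseteq> ?D" for z R' w'
  proof (rule ccontr)
    assume "\<not> ?thesis"
    moreover have "R' > 0" using that(2) Rpos[OF that(1)] \<gamma>' by (smt (verit) mult_pos_pos)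
    ultimately have "adm R' w'" using that unfolding adm_def by simp
    from Rmax[OF that(1) this that(3)] that(2) show False by simp
  qed
  \<comment> \<open>A cylinder contains its own centre, on the top face, so lying in Q_r bounds the
    time of the centre.\<close>
  have wtime: "fst (w z) \<le> 0" if "z \<in> K" for z
    using center_in_kin_cyl[OF Rpos[OF that], of "w z"] Rsub[OF that] fst_kin_cyl0 by blast
  have Qin: "z \<in> interior (Q z)" if "z \<in> K" for z
    unfolding Q_def using Rin[OF that] interior_mono[OF kin_cyl_mono[of "R z" "\<rho> z" "w z"]] Rpos[OF that] rho[OF that] by auto
  have sub: "kin_cyl R' w' \<subseteq> ?D" if "z \<in> K" "z \<in> kin_cyl R' w'" "fst w' \<le> 0" "0 < R'" "3 * R' \<le> r - s" for z R' w'
  proof -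
    have "kin_cyl R' w' \<subseteq> kin_cyl0 (s + 3 * R')"
      using that K(2) sr by (intro kin_cyl_subset_kin_cyl0) auto
    also have "\<dots> \<subseteq> ?D" using that sr by (intro kin_cyl0_mono) auto
    finally show ?thesis .
  qed
  have Qsub: "Q z \<subseteq> ?D" if "z \<in> K" for z
    unfolding Q_def
    using that Qin[OF that] interior_subset[of "Q z"] wtime[OF that] rho[OF that] Rsmall[OF that] sr
    by (intro sub[of z]) (auto simp: Q_def)
  have Qlarge: "(LINT y:Q z|lebesgue. g y powr q) \<le> ?a * measure lebesgue (Q z)" if "z \<in> K" for z
    using large[OF that rho(3)[OF that], of "w z"] Qin[OF that] Qsub[OF that] by (simp add: Q_def)
  have Qest: "?a * measure lebesgue (Q z)
    \<le> c_g * lam powr (q - 1) * (LINT z:Q z|lebesgue. upper_part (lam / c_g) g z)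
      + 8 * b * (LINT z:Q z|lebesgue. upper_part (?a / (8 * b)) (\<lambda>z. h z powr q) z)" if "z \<in> K" for z
    unfolding Q_def \<rho>_def
    using Qlarge[OF that] Qsub[OF that] DD unfolding Q_def \<rho>_def
    by (intro stopping_estimate[OF Rpos[OF that] lam _ Rlow[OF that]]) simp_all
  obtain I where I: "I \<subseteq> K" "finite I" "K \<subseteq> (\<Union>z\<in>I. interior (Q z))"
  proof (rule compactE_image[OF K(1), of K "\<lambda>z. interior (Q z)"])
    show "K \<subseteq> (\<Union>z\<in>K. interior (Q z))" using Qin by blast
  qed auto
  obtain J where J: "J \<subseteq> I" "disjoint_family_on Q J" "\<And>i. i \<in> I \<Longrightarrow> \<exists>j\<in>J. \<rho> i \<le> \<rho> j \<and> Q i \<inter> Q j \<noteq> {}"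
  proof (rule finite_vitali[of I Q \<rho>])
    show "Q i \<noteq> {}" if "i \<in> I" for i
      using Qin[of i] that I(1) interior_subset[of "Q i"] by blast
  qed (use I(2) in blast)+
  have "finite J" using J(1) I(2) by (rule finite_subset)
  have JK: "j \<in> K" if "j \<in> J" for j using that J I by auto
  have "\<forall>j\<in>J. \<exists>u. fst u \<le> 0 \<and> (\<forall>i\<in>I. \<rho> i \<le> \<rho> j \<longrightarrow> Q i \<inter> Q j \<noteq> {} \<longrightarrow> Q i \<subseteq> kin_cyl (3 * \<rho> j) u)"
  proof
    fix j assume j: "j \<in> J"
    obtain u where u: "fst u \<le> 0" "\<And>w' \<rho>'. \<lbrakk>0 < \<rho>'; \<rho>' \<le> \<rho> j; fst w' \<le> 0; kin_cyl \<rho>' w' \<inter> kin_cyl (\<rho> j) (w j) \<noteq> {}\<rbrakk>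
      \<Longrightarrow> kin_cyl \<rho>' w' \<subseteq> kin_cyl (3 * \<rho> j) u"
      by (rule kin_cyl_engulf[OF rho(1)[OF JK[OF j]] wtime[OF JK[OF j]]]) blast
    have "Q i \<subseteq> kin_cyl (3 * \<rho> j) u" if "i \<in> I" "\<rho> i \<le> \<rho> j" "Q i \<inter> Q j \<noteq> {}" for i
      unfolding Q_def using that rho(1)[of i] wtime[of i] I(1) by (intro u(2)) (auto simp: Q_def)
    with u(1) show "\<exists>u. fst u \<le> 0 \<and> (\<forall>i\<in>I. \<rho> i \<le> \<rho> j \<longrightarrow> Q i \<inter> Q j \<noteq> {} \<longrightarrow> Q i \<subseteq> kin_cyl (3 * \<rho> j) u)"
      by blast
  qed
  then obtain u where u: "\<forall>j\<in>J. fst (u j) \<le> 0 \<and> (\<forall>i\<in>I. \<rho> i \<le> \<rho> j \<longrightarrow> Q i \<inter> Q j \<noteq> {} \<longrightarrow> Q i \<subseteq> kin_cyl (3 * \<rho> j) (u j))"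
    unfolding bchoice_iff by blast
  define E where "E j = kin_cyl (3 * \<rho> j) (u j)" for j
  have QE: "Q i \<subseteq> E j" if "j \<in> J" "i \<in> I" "\<rho> i \<le> \<rho> j" "Q i \<inter> Q j \<noteq> {}" for i j
    using u that unfolding E_def by blast
  have utime: "fst (u j) \<le> 0" if "j \<in> J" for j using u that by blast
  have cover: "K \<subseteq> (\<Union>j\<in>J. E j)"
  proof
    fix z assume "z \<in> K"
    then obtain i where i: "i \<in> I" "z \<in> interior (Q i)" using I(3) by blast
    obtain j where j: "j \<in> J" "\<rho> i \<le> \<rho> j" "Q i \<inter> Q j \<noteq> {}" using J(3)[OF i(1)] by blast
    have "z \<in> E j" using QE[OF j(1) i(1) j(2,3)] i(2) interior_subset[of "Q i"] by blast
    with j(1) show "z \<in> (\<Union>j\<in>J. E j)" by blast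
  qed
  \<comment> \<open>The point j is interior to \<open>Q j\<close>, which lies in \<open>E j\<close>;
    this makes \<open>E j\<close> a competitor at j, so that \<open>large\<close> applies to
    it.\<close>
  have Ein: "j \<in> interior (E j)" if "j \<in> J" for j
  proof -
    have "j \<in> interior (Q j)" by (rule Qin[OF JK[OF that]])
    then have "Q j \<inter> Q j \<noteq> {}" using interior_subset[of "Q j"] by blast
    with QE[OF that _ order_refl this] that J(1) have "Q j \<subseteq> E j" by blast
    with \<open>j \<in> interior (Q j)\<close> show ?thesis using interior_mono[of "Q j" "E j"] by blast
  qed
  have Esub: "E j \<subseteq> ?D" if "j \<in> J" for j
    unfolding E_def
    using JK[OF that] Ein[OF that] interior_subset[of "E j"] utime[OF that] rho[OF JK[OF that]] Rsmall[OF JK[OF that]]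
    by (intro sub[of j]) (auto simp: E_def)
  have Elarge: "(LINT y:E j|lebesgue. g y powr q) \<le> 3 ^ (4 * CARD('d) + 2) * (?a * measure lebesgue (Q j))" if "j \<in> J" for j
  proof -
    note j = JK[OF that]
    have "\<gamma>' * R j \<le> 3 * \<rho> j" using rho[OF j] by simp
    from large[OF j this, of "u j"] Ein[OF that] Esub[OF that]
    have "(LINT y:E j|lebesgue. g y powr q) \<le> ?a * measure lebesgue (E j)" by (simp add: E_def)
    also have "measure lebesgue (E j) = 3 ^ (4 * CARD('d) + 2) * measure lebesgue (Q j)"
      unfolding E_def Q_def using rho(1)[OF j]
      by (subst (1 2) measure_kin_cyl) (simp_all add: power_mult_distrib)
    finally show ?thesis by (simp add: mult_ac)
  qed
  let ?g = "\<lambda>S. LINT z:S|lebesgue. upper_part (lam / c_g) g z"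
  let ?h = "\<lambda>S. LINT z:S|lebesgue. upper_part (?a / (8 * b)) (\<lambda>z. h z powr q) z"
  have "(LINT z:K|lebesgue. g z powr q) \<le> (\<Sum>j\<in>J. LINT z:E j|lebesgue. g z powr q)"
  proof (rule set_integral_le_sum_cover[OF int(2) _ \<open>finite J\<close>])
    show "E j \<subseteq> ?D" if "j \<in> J" for j by (rule Esub[OF that])
    show "K \<in> sets lebesgue" using K(1) by (simp add: compact_imp_closed)
  qed (use cover in \<open>simp_all add: E_def\<close>)
  also have "\<dots> \<le> (\<Sum>j\<in>J. 3 ^ (4 * CARD('d) + 2) * (c_g * lam powr (q - 1) * ?g (Q j) + 8 * b * ?h (Q j)))"
  proof (rule sum_mono)
    fix j assume j: "j \<in> J"
    have "3 ^ (4 * CARD('d) + 2) * (?a * measure lebesgue (Q j)) \<le> 3 ^ (4 * CARD('d) + 2) * (c_g * lam powr (q - 1) * ?g (Q j) + 8 * b * ?h (Q j))"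
      by (rule mult_left_mono[OF Qest[OF JK[OF j]]]) simp
    with Elarge[OF j] show "(LINT y:E j|lebesgue. g y powr q) \<le> 3 ^ (4 * CARD('d) + 2) * (c_g * lam powr (q - 1) * ?g (Q j) + 8 * b * ?h (Q j))"
      by (rule order_trans)
  qed
  also have "\<dots> = 3 ^ (4 * CARD('d) + 2) * (c_g * lam powr (q - 1) * (\<Sum>j\<in>J. ?g (Q j)) + 8 * b * (\<Sum>j\<in>J. ?h (Q j)))"
    by (simp only: sum_distrib_left[symmetric] sum.distrib)
  also have "\<dots> \<le> 3 ^ (4 * CARD('d) + 2) * (c_g * lam powr (q - 1) * ?g ?D + 8 * b * ?h ?D)"
  proof -
    have 1: "(\<Sum>j\<in>J. ?g (Q j)) \<le> ?g ?D"
      using c_g_pos lam JK Qsub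
      by (intro set_integral_disjoint_sum_le[OF set_integrable_upper_part[OF int(1)] _ \<open>finite J\<close> J(2)] upper_part_nonneg) (auto simp: Q_def)
    have 2: "(\<Sum>j\<in>J. ?h (Q j)) \<le> ?h ?D"
      using b lam JK Qsub
      by (intro set_integral_disjoint_sum_le[OF set_integrable_upper_part[OF int(3)] _ \<open>finite J\<close> J(2)] upper_part_nonneg) (auto simp: Q_def)
    show ?thesis
      using 1 2 c_g_pos b by (intro mult_left_mono add_mono) auto
  qed
  finally show ?thesis .
qed

end

section \<open>Layer cake and hole filling\<close>

text \<open>The layer-cake weight for the power \<beta>. For \<beta> < 1 it is singular at 0 but
  still integrable, which matters because \<beta> = p - q may be small.\<close>

lemma nn_integral_powr_lessThan:
  fixes \<beta> m :: real
  assumes "\<beta> > 0" "m \<ge> 0"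
  shows "(\<integral>\<^sup>+t. (if 0 < t \<and> t < m then ennreal (\<beta> * t powr (\<beta> - 1)) else 0) \<partial>lborel) = ennreal (m powr \<beta>)"
proof -
  have "((\<lambda>t. \<beta> * t powr (\<beta> - 1)) has_integral (\<beta> * (m powr (\<beta> - 1 + 1) / (\<beta> - 1 + 1)))) {0..m}"
    using assms by (intro has_integral_mult_right has_integral_powr_from_0) auto
  then have "(\<integral>\<^sup>+t. ennreal (\<beta> * t powr (\<beta> - 1)) * indicator {0..m} t \<partial>lborel) = ennreal (m powr \<beta>)"
    using assms by (subst nn_integral_has_integral_lebesgue'[of "{0..m}"]) auto
  moreover have "(\<integral>\<^sup>+t. ennreal (\<beta> * t powr (\<beta> - 1)) * indicator {0..m} t \<partial>lborel) =
      (\<integral>\<^sup>+t. (if 0 < t \<and> t < m then ennreal (\<beta> * t powr (\<beta> - 1)) else 0) \<partial>lborel)"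
  proof (rule nn_integral_cong_AE)
    show "AE t in lborel. ennreal (\<beta> * t powr (\<beta> - 1)) * indicator {0..m} t =
      (if 0 < t \<and> t < m then ennreal (\<beta> * t powr (\<beta> - 1)) else 0)"
      using AE_lborel_singleton[of m] by eventually_elim (auto simp: indicator_def)
  qed
  ultimately show ?thesis by simp
qed

text \<open>\<open>hyp\<close> is integrated in t over (l0, k) against (p - q) t^(p-q-1), and
  Tonelli exchanges the integrals. Levels below \<open>l0\<close> cost l0^(p-q) times the integral
  of u^q. In the w-term the powers of t combine to (p - q) t^(p-2), whose integral yields the factor
  (p - q)/(p - 1), the source of smallness for p near q. Cutting the weight at k produces the
  truncated powers.\<close>

lemma layer_cake_absorb:
  fixes u w v :: "'a \<Rightarrow> real"
  assumes M: "sigma_finite_measure M"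
    and [measurable]: "u \<in> borel_measurable M" "w \<in> borel_measurable M" "v \<in> borel_measurable M"
    and nn: "\<And>z. 0 \<le> u z" "\<And>z. 0 \<le> w z" "\<And>z. 0 \<le> v z"
    and pq: "1 < q" "q < p" and "l0 \<ge> 0" "B \<ge> 1" "B' \<ge> 0" "c1 \<ge> 0" "c2 \<ge> 0" "k \<ge> 0"
    and hyp: "\<And>t. t > l0 \<Longrightarrow> (\<integral>\<^sup>+z. (if t < u z then ennreal (u z powr q) else 0) \<partial>M)
      \<le> ennreal (c1 * t powr (q - 1)) * (\<integral>\<^sup>+z. (if t < B * w z then ennreal (w z) else 0) \<partial>M)
        + ennreal c2 * (\<integral>\<^sup>+z. (if t < B' * v z then ennreal (v z powr q) else 0) \<partial>M)"
  shows "(\<integral>\<^sup>+z. ennreal (u z powr q * min (u z) k powr (p - q)) \<partial>M)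
    \<le> ennreal (l0 powr (p - q)) * (\<integral>\<^sup>+z. ennreal (u z powr q) \<partial>M)
      + ennreal (c1 * ((p - q) / (p - 1)) * B powr (p - 1)) * (\<integral>\<^sup>+z. ennreal (w z powr q * min (w z) k powr (p - q)) \<partial>M)
      + ennreal (c2 * B' powr (p - q)) * (\<integral>\<^sup>+z. ennreal (v z powr p) \<partial>M)"
proof -
  interpret pair_sigma_finite M lborel
    using M sigma_finite_lborel by (rule pair_sigma_finite.intro)
  define wt where "wt t = (if l0 < t \<and> t < k then ennreal ((p - q) * t powr (p - q - 1)) else 0)" for t :: real
  have [measurable]: "wt \<in> borel_measurable lborel" unfolding wt_def by measurable
  let ?U = "\<lambda>z t. if t < u z then ennreal (u z powr q) else 0"
  let ?W = "\<lambda>z t. ennreal (c1 * t powr (q - 1)) * (if t < B * w z then ennreal (w z) else 0)"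
  let ?V = "\<lambda>z t. ennreal c2 * (if t < B' * v z then ennreal (v z powr q) else 0)"
  have u: "ennreal (u z powr q * min (u z) k powr (p - q))
      \<le> ennreal (l0 powr (p - q)) * ennreal (u z powr q) + (\<integral>\<^sup>+t. wt t * ?U z t \<partial>lborel)" for z
  proof -
    let ?m = "min (u z) k"
    have m: "?m \<ge> 0" using nn(1) \<open>k \<ge> 0\<close> by simp
    have pos: "p - q > 0" using pq by simp
    have "ennreal (?m powr (p - q)) = (\<integral>\<^sup>+t. (if 0 < t \<and> t < ?m then ennreal ((p - q) * t powr (p - q - 1)) else 0) \<partial>lborel)"
      by (rule nn_integral_powr_lessThan[OF pos m, symmetric])
    also have "\<dots> \<le> (\<integral>\<^sup>+t. (if 0 < t \<and> t < l0 then ennreal ((p - q) * t powr (p - q - 1)) else 0)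
        + (if t < u z then wt t else 0) \<partial>lborel)"
    proof (rule nn_integral_mono_AE)
      show "AE t in lborel. (if 0 < t \<and> t < ?m then ennreal ((p - q) * t powr (p - q - 1)) else 0)
        \<le> (if 0 < t \<and> t < l0 then ennreal ((p - q) * t powr (p - q - 1)) else 0) + (if t < u z then wt t else 0)"
        using AE_lborel_singleton[of l0] by eventually_elim (auto simp: wt_def)
    qed
    also have "\<dots> = ennreal (l0 powr (p - q)) + (\<integral>\<^sup>+t. (if t < u z then wt t else 0) \<partial>lborel)"
      by (subst nn_integral_add) (simp_all add: nn_integral_powr_lessThan[OF pos \<open>l0 \<ge> 0\<close>])
    finally have "ennreal (u z powr q) * ennreal (?m powr (p - q))
      \<le> ennreal (u z powr q) * (ennreal (l0 powr (p - q)) + (\<integral>\<^sup>+t. (if t < u z then wt t else 0) \<partial>lborel))"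
      by (rule mult_left_mono) simp
    also have "\<dots> = ennreal (l0 powr (p - q)) * ennreal (u z powr q) + (\<integral>\<^sup>+t. ennreal (u z powr q) * (if t < u z then wt t else 0) \<partial>lborel)"
      by (subst nn_integral_cmult) (simp_all add: distrib_left mult.commute)
    also have "(\<integral>\<^sup>+t. ennreal (u z powr q) * (if t < u z then wt t else 0) \<partial>lborel) = (\<integral>\<^sup>+t. wt t * ?U z t \<partial>lborel)"
      by (intro nn_integral_cong) (simp add: mult.commute)
    finally show ?thesis by (simp add: ennreal_mult'')
  qed
  have w: "(\<integral>\<^sup>+t. wt t * ?W z t \<partial>lborel) \<le>
      ennreal (c1 * ((p - q) / (p - 1)) * B powr (p - 1)) * ennreal (w z powr q * min (w z) k powr (p - q))" for z
  proof -
    let ?m = "min (w z) k"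
    have m: "?m \<ge> 0" "min k (B * w z) \<ge> 0" using nn(2) \<open>k \<ge> 0\<close> \<open>B \<ge> 1\<close> by simp_all
    have pos: "p - 1 > 0" using pq by simp
    have "(\<integral>\<^sup>+t. wt t * ?W z t \<partial>lborel) \<le> (\<integral>\<^sup>+t. ennreal (c1 * ((p - q) / (p - 1)) * w z) *
        (if 0 < t \<and> t < min k (B * w z) then ennreal ((p - 1) * t powr (p - 1 - 1)) else 0) \<partial>lborel)"
    proof (rule nn_integral_mono)
      fix t
      show "wt t * ?W z t \<le> ennreal (c1 * ((p - q) / (p - 1)) * w z) *
        (if 0 < t \<and> t < min k (B * w z) then ennreal ((p - 1) * t powr (p - 1 - 1)) else 0)"
      proof (cases "l0 < t \<and> t < k \<and> t < B * w z")
        case True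
        have "t powr (p - q - 1) * t powr (q - 1) = t powr (p - 1 - 1)"
          by (simp add: powr_add[symmetric])
        then have "(p - q) * t powr (p - q - 1) * (c1 * t powr (q - 1) * w z) =
            c1 * ((p - q) / (p - 1)) * w z * ((p - 1) * t powr (p - 1 - 1))"
          using pos by (simp add: field_simps)
        then have "ennreal ((p - q) * t powr (p - q - 1)) * (ennreal (c1 * t powr (q - 1)) * ennreal (w z)) =
            ennreal (c1 * ((p - q) / (p - 1)) * w z) * ennreal ((p - 1) * t powr (p - 1 - 1))"
          using pq nn(2) \<open>c1 \<ge> 0\<close> by (simp add: ennreal_mult[symmetric] del: ennreal_mult)
        with True \<open>l0 \<ge> 0\<close> show ?thesis by (simp add: wt_def)
      qed (auto simp: wt_def)
    qed
    also have "\<dots> = ennreal (c1 * ((p - q) / (p - 1)) * w z) * ennreal (min k (B * w z) powr (p - 1))"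
      by (subst nn_integral_cmult) (simp, subst nn_integral_powr_lessThan[OF pos m(2)], simp)
    also have "\<dots> = ennreal (c1 * ((p - q) / (p - 1)) * w z * min k (B * w z) powr (p - 1))"
      using pq nn(2) \<open>c1 \<ge> 0\<close> by (subst ennreal_mult[symmetric]) auto
    also have "\<dots> \<le> ennreal (c1 * ((p - q) / (p - 1)) * B powr (p - 1) * (w z powr q * ?m powr (p - q)))"
    proof (rule ennreal_leI)
      \<comment> \<open>B \<ge> 1 lets the truncation pass inside: min(k, B w) \<le> B min(w, k).
        The right side is thus truncated at the same k as the left, as absorption requires.\<close>
      have "k \<le> B * k" using \<open>k \<ge> 0\<close> \<open>B \<ge> 1\<close> by (simp add: mult_le_cancel_right1)
      then have "min k (B * w z) \<le> B * ?m" by (cases "w z \<le> k") (auto simp: min.coboundedI1)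
      then have "min k (B * w z) powr (p - 1) \<le> (B * ?m) powr (p - 1)"
        using m pos by (intro powr_mono2) auto
      also have "\<dots> = B powr (p - 1) * (?m powr (q - 1) * ?m powr (p - q))"
        using m \<open>B \<ge> 1\<close> by (simp add: powr_mult powr_add[symmetric])
      finally have "w z * min k (B * w z) powr (p - 1) \<le> w z * (B powr (p - 1) * (?m powr (q - 1) * ?m powr (p - q)))"
        using nn(2) by (rule mult_left_mono)
      \<comment> \<open>Of the p - 1 truncated powers only p - q are kept; the other q - 1 are
        bounded by powers of w and join the single factor w to form w^q.\<close>
      also have "\<dots> \<le> w z * (B powr (p - 1) * (w z powr (q - 1) * ?m powr (p - q)))"
        using nn(2) m pq by (intro mult_left_mono mult_right_mono powr_mono2) auto
      also have "\<dots> = B powr (p - 1) * ((w z powr 1 * w z powr (q - 1)) * ?m powr (p - q))"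
        using nn(2) by (simp add: mult_ac)
      also have "w z powr 1 * w z powr (q - 1) = w z powr q"
        unfolding powr_add[symmetric] by simp
      finally have "w z * min k (B * w z) powr (p - 1) \<le> B powr (p - 1) * (w z powr q * ?m powr (p - q))" .
      from mult_left_mono[OF this, of "c1 * ((p - q) / (p - 1))"]
      show "c1 * ((p - q) / (p - 1)) * w z * min k (B * w z) powr (p - 1)
         \<le> c1 * ((p - q) / (p - 1)) * B powr (p - 1) * (w z powr q * ?m powr (p - q))"
        using \<open>c1 \<ge> 0\<close> pq by (simp add: mult.assoc)
    qed
    also have "\<dots> = ennreal (c1 * ((p - q) / (p - 1)) * B powr (p - 1)) * ennreal (w z powr q * ?m powr (p - q))"
      using pq \<open>c1 \<ge> 0\<close> by (subst ennreal_mult[symmetric]) auto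
    finally show ?thesis .
  qed
  have v: "(\<integral>\<^sup>+t. wt t * ?V z t \<partial>lborel) \<le> ennreal (c2 * B' powr (p - q)) * ennreal (v z powr p)" for z
  proof -
    have m: "B' * v z \<ge> 0" using nn(3) \<open>B' \<ge> 0\<close> by simp
    have pos: "p - q > 0" using pq by simp
    have "(\<integral>\<^sup>+t. wt t * ?V z t \<partial>lborel) \<le> (\<integral>\<^sup>+t. ennreal (c2 * v z powr q) *
        (if 0 < t \<and> t < B' * v z then ennreal ((p - q) * t powr (p - q - 1)) else 0) \<partial>lborel)"
      using \<open>l0 \<ge> 0\<close> \<open>c2 \<ge> 0\<close> by (intro nn_integral_mono) (auto simp: wt_def ennreal_mult mult_ac)
    also have "\<dots> = ennreal (c2 * v z powr q) * ennreal ((B' * v z) powr (p - q))"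
      by (subst nn_integral_cmult) (simp, subst nn_integral_powr_lessThan[OF pos m], simp)
    also have "\<dots> = ennreal (c2 * B' powr (p - q) * (v z powr q * v z powr (p - q)))"
      using nn(3) \<open>B' \<ge> 0\<close> \<open>c2 \<ge> 0\<close> by (simp add: ennreal_mult[symmetric] powr_mult mult_ac)
    also have "v z powr q * v z powr (p - q) = v z powr p" by (simp add: powr_add[symmetric])
    finally show ?thesis using \<open>c2 \<ge> 0\<close> by (simp add: ennreal_mult)
  qed
  have "(\<integral>\<^sup>+z. ennreal (u z powr q * min (u z) k powr (p - q)) \<partial>M)
    \<le> (\<integral>\<^sup>+z. ennreal (l0 powr (p - q)) * ennreal (u z powr q) + (\<integral>\<^sup>+t. wt t * ?U z t \<partial>lborel) \<partial>M)"
    by (intro nn_integral_mono u)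
  also have "\<dots> = ennreal (l0 powr (p - q)) * (\<integral>\<^sup>+z. ennreal (u z powr q) \<partial>M) + (\<integral>\<^sup>+z. \<integral>\<^sup>+t. wt t * ?U z t \<partial>lborel \<partial>M)"
    by (subst nn_integral_add) (simp_all add: nn_integral_cmult)
  also have "(\<integral>\<^sup>+z. \<integral>\<^sup>+t. wt t * ?U z t \<partial>lborel \<partial>M) = (\<integral>\<^sup>+t. \<integral>\<^sup>+z. wt t * ?U z t \<partial>M \<partial>lborel)"
    by (rule Fubini'[symmetric]) measurable
  also have "\<dots> \<le> (\<integral>\<^sup>+t. \<integral>\<^sup>+z. wt t * (?W z t + ?V z t) \<partial>M \<partial>lborel)"
  proof (rule nn_integral_mono)
    fix t :: real
    have "(\<integral>\<^sup>+z. wt t * ?U z t \<partial>M) = wt t * (\<integral>\<^sup>+z. ?U z t \<partial>M)"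
      by (rule nn_integral_cmult) measurable
    also have "\<dots> \<le> wt t * (\<integral>\<^sup>+z. ?W z t + ?V z t \<partial>M)"
    proof (cases "l0 < t")
      case True
      have "(\<integral>\<^sup>+z. ?W z t + ?V z t \<partial>M) = ennreal (c1 * t powr (q - 1)) * (\<integral>\<^sup>+z. (if t < B * w z then ennreal (w z) else 0) \<partial>M)
        + ennreal c2 * (\<integral>\<^sup>+z. (if t < B' * v z then ennreal (v z powr q) else 0) \<partial>M)"
        by (subst nn_integral_add) (measurable, measurable, subst (1 2) nn_integral_cmult, measurable, measurable)
      with hyp[OF True] show ?thesis by (intro mult_left_mono) simp_all
    qed (simp add: wt_def)
    also have "\<dots> = (\<integral>\<^sup>+z. wt t * (?W z t + ?V z t) \<partial>M)"
      by (rule nn_integral_cmult[symmetric]) measurable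
    finally show "(\<integral>\<^sup>+z. wt t * ?U z t \<partial>M) \<le> (\<integral>\<^sup>+z. wt t * (?W z t + ?V z t) \<partial>M)" .
  qed
  also have "(\<integral>\<^sup>+t. \<integral>\<^sup>+z. wt t * (?W z t + ?V z t) \<partial>M \<partial>lborel) = (\<integral>\<^sup>+z. \<integral>\<^sup>+t. wt t * (?W z t + ?V z t) \<partial>lborel \<partial>M)"
    by (rule Fubini') measurable
  also have "\<dots> \<le> (\<integral>\<^sup>+z. ennreal (c1 * ((p - q) / (p - 1)) * B powr (p - 1)) * ennreal (w z powr q * min (w z) k powr (p - q))
      + ennreal (c2 * B' powr (p - q)) * ennreal (v z powr p) \<partial>M)"
  proof (rule nn_integral_mono)
    fix z assume "z \<in> space M"
    have "(\<integral>\<^sup>+t. wt t * (?W z t + ?V z t) \<partial>lborel) = (\<integral>\<^sup>+t. wt t * ?W z t \<partial>lborel) + (\<integral>\<^sup>+t. wt t * ?V z t \<partial>lborel)"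
      unfolding distrib_left by (rule nn_integral_add) measurable
    also have "\<dots> \<le> ennreal (c1 * ((p - q) / (p - 1)) * B powr (p - 1)) * ennreal (w z powr q * min (w z) k powr (p - q))
      + ennreal (c2 * B' powr (p - q)) * ennreal (v z powr p)"
      by (rule add_mono[OF w v])
    finally show "(\<integral>\<^sup>+t. wt t * (?W z t + ?V z t) \<partial>lborel) \<le> \<dots>" .
  qed
  also have "\<dots> = ennreal (c1 * ((p - q) / (p - 1)) * B powr (p - 1)) * (\<integral>\<^sup>+z. ennreal (w z powr q * min (w z) k powr (p - q)) \<partial>M)
      + ennreal (c2 * B' powr (p - q)) * (\<integral>\<^sup>+z. ennreal (v z powr p) \<partial>M)"
    by (subst nn_integral_add) (simp_all add: nn_integral_cmult)
  finally show ?thesis by (simp add: add.assoc add_left_mono)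
qed

text \<open>The inequality is iterated along radii increasing to \<gamma> with gaps in geometric
  progression of ratio \<tau>, so that \<kappa>^i beats the growth \<tau>^(-\<alpha> i) of the gap
  penalty. M only makes \<kappa>^i \<Phi> vanish in the limit, and K does not depend on it; in the
  application M grows with the truncation level.\<close>

lemma hole_filling:
  fixes \<kappa> \<alpha> \<gamma> :: real
  assumes "0 < \<kappa>" "\<kappa> < 1" "0 \<le> \<alpha>" "1 < \<gamma>"
  obtains K where "K > 0" "\<And>\<Phi> A B M. \<lbrakk>0 \<le> A; 0 \<le> B; \<And>s. 1 \<le> s \<Longrightarrow> s \<le> \<gamma> \<Longrightarrow> \<Phi> s \<le> M;
    \<And>s r. 1 \<le> s \<Longrightarrow> s < r \<Longrightarrow> r \<le> \<gamma> \<Longrightarrow> \<Phi> s \<le> \<kappa> * \<Phi> r + A * (r - s) powr (- \<alpha>) + B\<rbrakk> \<Longrightarrow> \<Phi> 1 \<le> K * (A + B)"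
proof -
  \<comment> \<open>What counts is \<tau> < 1 and \<tau>^\<alpha> > \<kappa>; the base lies strictly
    between \<kappa> and 1. Taking \<alpha> + 1 instead of \<alpha> in the exponent keeps the
    formula meaningful for \<alpha> = 0.\<close>
  define \<tau> where "\<tau> = ((1 + \<kappa>) / 2) powr (1 / (\<alpha> + 1))"
  have "\<tau> < 1 powr (1 / (\<alpha> + 1))" unfolding \<tau>_def using assms by (intro powr_less_mono2) auto
  then have \<tau>: "0 < \<tau>" "\<tau> < 1" using assms by (auto simp: \<tau>_def)
  have "\<tau> powr \<alpha> = ((1 + \<kappa>) / 2) powr (\<alpha> / (\<alpha> + 1))" by (simp add: \<tau>_def powr_powr)
  also have "\<dots> \<ge> ((1 + \<kappa>) / 2) powr 1" using assms by (intro powr_mono') (auto simp: field_simps)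
  finally have \<tau>\<alpha>: "\<tau> powr \<alpha> > \<kappa>" using assms by simp
  define x where "x = \<kappa> * \<tau> powr (- \<alpha>)"
  have x: "0 < x" "x < 1" using \<tau>\<alpha> \<tau> assms by (auto simp: x_def powr_minus field_simps)
  have "\<tau> powr (- \<alpha>) \<ge> 1" using \<tau> assms powr_mono'[of "- \<alpha>" 0 \<tau>] by simp
  then have \<kappa>x: "\<kappa> \<le> x" using assms by (simp add: x_def mult_le_cancel_left1)
  define D where "D = ((\<gamma> - 1) * (1 - \<tau>)) powr (- \<alpha>)"
  have D: "D > 0" using assms \<tau> by (simp add: D_def)
  define rad where "rad i = 1 + (\<gamma> - 1) * (1 - \<tau> ^ i)" for i :: nat
  have rad: "1 \<le> rad i" "rad i < rad (Suc i)" "rad i \<le> \<gamma>" for i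
  proof -
    have t: "0 < \<tau> ^ i" "\<tau> ^ i \<le> 1" "\<tau> ^ Suc i < \<tau> ^ i" using \<tau> by (auto simp: power_le_one)
    show "1 \<le> rad i" "rad i < rad (Suc i)" using t assms by (auto simp: rad_def)
    have "(\<gamma> - 1) * (1 - \<tau> ^ i) \<le> (\<gamma> - 1) * 1" using t assms by (intro mult_left_mono) auto
    then show "rad i \<le> \<gamma>" by (simp add: rad_def)
  qed
  have gap: "(rad (Suc i) - rad i) powr (- \<alpha>) = D * (\<tau> powr (- \<alpha>)) ^ i" for i
  proof -
    have "rad (Suc i) - rad i = (\<gamma> - 1) * (1 - \<tau>) * \<tau> ^ i" by (simp add: rad_def algebra_simps)
    then show ?thesis
      using assms \<tau> by (simp add: D_def powr_mult powr_realpow[symmetric] powr_powr mult.commute)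
  qed
  show thesis
  proof (rule that[of "(D + 1) / (1 - x)"])
    show "(D + 1) / (1 - x) > 0" using D x by simp
    fix \<Phi> :: "real \<Rightarrow> real" and A B M
    assume AB: "0 \<le> A" "0 \<le> B" and M: "\<And>s. 1 \<le> s \<Longrightarrow> s \<le> \<gamma> \<Longrightarrow> \<Phi> s \<le> M"
      and step: "\<And>s r. 1 \<le> s \<Longrightarrow> s < r \<Longrightarrow> r \<le> \<gamma> \<Longrightarrow> \<Phi> s \<le> \<kappa> * \<Phi> r + A * (r - s) powr (- \<alpha>) + B"
    have it: "\<Phi> 1 \<le> \<kappa> ^ i * \<Phi> (rad i) + (D * A + B) * (\<Sum>j<i. x ^ j)" for i
    proof (induction i)
      case 0
      show ?case by (simp add: rad_def)
    next
      case (Suc i)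
      have "\<Phi> (rad i) \<le> \<kappa> * \<Phi> (rad (Suc i)) + A * (rad (Suc i) - rad i) powr (- \<alpha>) + B"
        using rad by (intro step)
      then have "\<kappa> ^ i * \<Phi> (rad i) \<le> \<kappa> ^ i * (\<kappa> * \<Phi> (rad (Suc i)) + A * (rad (Suc i) - rad i) powr (- \<alpha>) + B)"
        using assms by (intro mult_left_mono) auto
      also have "\<dots> = \<kappa> ^ Suc i * \<Phi> (rad (Suc i)) + D * A * x ^ i + B * \<kappa> ^ i"
        unfolding gap x_def by (simp add: algebra_simps power_mult_distrib)
      \<comment> \<open>As \<kappa> \<le> x, the B-terms join the geometric series of the
        A-terms.\<close>
      also have "\<dots> \<le> \<kappa> ^ Suc i * \<Phi> (rad (Suc i)) + D * A * x ^ i + B * x ^ i"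
        using assms AB \<kappa>x by (intro add_left_mono mult_left_mono power_mono) auto
      finally show ?case using Suc by (simp add: algebra_simps)
    qed
    have sum: "(\<Sum>j<i. x ^ j) \<le> 1 / (1 - x)" for i
      using x by (subst sum_gp_strict) (auto simp: divide_right_mono)
    have "\<Phi> 1 \<le> \<kappa> ^ i * M + (D * A + B) * (1 / (1 - x))" for i
    proof -
      have "\<kappa> ^ i * \<Phi> (rad i) \<le> \<kappa> ^ i * M" using rad M assms by (intro mult_left_mono) auto
      moreover have "(D * A + B) * (\<Sum>j<i. x ^ j) \<le> (D * A + B) * (1 / (1 - x))"
        using D AB sum by (intro mult_left_mono) auto
      ultimately show ?thesis using it[of i] by linarith
    qed
    moreover have "(\<lambda>i. \<kappa> ^ i * M + (D * A + B) * (1 / (1 - x))) \<longlonglongrightarrow> 0 * M + (D * A + B) * (1 / (1 - x))"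
      using assms by (intro tendsto_intros LIMSEQ_power_zero) auto
    ultimately have "\<Phi> 1 \<le> 0 * M + (D * A + B) * (1 / (1 - x))"
      by (intro LIMSEQ_le_const) auto
    also have "\<dots> = (D * A + B) * (1 / (1 - x))" by simp
    also have "\<dots> \<le> (D * (A + B) + 1 * (A + B)) * (1 / (1 - x))"
      using AB D x by (intro mult_right_mono add_mono mult_left_mono) auto
    finally show "\<Phi> 1 \<le> (D + 1) / (1 - x) * (A + B)" by (simp add: algebra_simps add_divide_distrib)
  qed
qed

lemma powr_less_powr_iff:
  fixes x y q :: real
  assumes "0 \<le> x" "0 \<le> y" "0 < q"
  shows "x < y \<longleftrightarrow> x powr q < y powr q"
  using assms powr_less_mono2[of q x y] powr_mono2[of q y x] by linarith

lemma nn_integral_indicator_eq: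
  assumes "set_integrable M S f" "\<And>z. z \<in> S \<Longrightarrow> 0 \<le> f z"
  shows "(\<integral>\<^sup>+z. ennreal (indicator S z * f z) \<partial>M) = ennreal (LINT z:S|M. f z)"
  unfolding set_lebesgue_integral_def real_scaleR_def
proof (rule nn_integral_eq_integral)
  show "integrable M (\<lambda>x. indicator S x * f x)"
    using assms(1) by (simp add: set_integrable_def)
  show "AE x in M. 0 \<le> indicator S x * f x"
    using assms(2) by (intro AE_I2) (auto simp: indicator_def)
qed

text \<open>Serves Tonelli in the layer-cake argument: a countable cover by Borel sets of finite
  measure works for the completion as well.\<close>

lemma sigma_finite_lebesgue: "sigma_finite_measure (lebesgue :: 'a::euclidean_space measure)"
proof
  obtain A :: "'a::euclidean_space set set" where A: "countable A" "A \<subseteq> sets lborel" "\<Union>A = space lborel" "\<forall>a\<in>A. emeasure lborel a \<noteq> \<infinity>"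
    using sigma_finite_measure.sigma_finite_countable[OF sigma_finite_lborel[where 'a="'a::euclidean_space"]] by (elim exE conjE)
  show "\<exists>A. countable A \<and> A \<subseteq> sets lebesgue \<and> \<Union>A = space lebesgue \<and> (\<forall>a\<in>A. emeasure (lebesgue :: 'a::euclidean_space measure) a \<noteq> \<infinity>)"
    using A by (intro exI[of _ A]) (auto simp: sets_completionI_sets)
qed

section \<open>Higher integrability\<close>

context reverse_hoelder
begin

text \<open>From compact sets to the whole superlevel set. Differentiation applies in the interior
  of Q_s, and the frontier is null because Q_s is convex. So almost all of {g > lam} in Q_s lies in
  the open union \<open>G\<close> of interiors of admissible cylinders. Up to a null set that
  intersection is an increasing union of compact sets, and the compact case bounds each of them by
  the same right side.\<close>

lemma level_estimate:
  assumes sr: "1 \<le> s" "s < r" "r \<le> \<gamma>" and lam: "lam > 0"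
    and big: "(9 * \<gamma>) ^ (4 * CARD('d) + 2) * total \<le> lam powr q * cyl_vol TYPE('d) * (r - s) ^ (4 * CARD('d) + 2)"
  shows "(LINT z:kin_cyl0 s|lebesgue. upper_part (lam powr q) (\<lambda>z. g z powr q) z) \<le> 3 ^ (4 * CARD('d) + 2) *
     (c_g * lam powr (q - 1) * (LINT z:kin_cyl0 r|lebesgue. upper_part (lam / c_g) g z)
      + 8 * b * (LINT z:kin_cyl0 r|lebesgue. upper_part (lam powr q / (8 * b)) (\<lambda>z. h z powr q) z))"
    (is "?lhs \<le> ?rhs")
proof -
  let ?D = "kin_cyl0 s :: 'd phase set" and ?\<mu> = "lam powr q" and ?f = "\<lambda>z. g z powr q"
  define \<Omega> where "\<Omega> = interior ?D"
  define good where "good R w \<longleftrightarrow> R > 0 \<and> kin_cyl R w \<subseteq> kin_cyl0 r \<and>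
    ?\<mu> * measure lebesgue (kin_cyl R w) < (LINT y:kin_cyl R w|lebesgue. ?f y)" for R w
  define G where "G = \<Union>{interior (kin_cyl R w) | R w. good R w}"
  have Gopen: "open G" unfolding G_def by auto
  have \<Omega>D: "\<Omega> \<subseteq> ?D" unfolding \<Omega>_def by (rule interior_subset)
  have DD: "?D \<subseteq> kin_cyl0 \<gamma>" and Dr: "?D \<subseteq> kin_cyl0 r" using sr by (intro kin_cyl0_mono; simp)+
  have Df: "set_integrable lebesgue ?D ?f"
    by (rule set_integrable_subset[OF gq_int kin_cyl0_lebesgue DD])
  have \<Omega>f: "set_integrable lebesgue \<Omega> ?f"
    by (rule set_integrable_subset[OF Df _ \<Omega>D]) (simp add: \<Omega>_def)
  have "AE z in lebesgue. z \<in> \<Omega> \<longrightarrow> ?f z > ?\<mu> \<longrightarrow> (\<exists>R>0. \<exists>w. z \<in> interior (kin_cyl R w) \<and>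
    kin_cyl R w \<subseteq> \<Omega> \<and> ?\<mu> * measure lebesgue (kin_cyl R w) < (LINT y:kin_cyl R w|lebesgue. ?f y))"
    by (rule kin_cyl_differentiation[OF _ \<Omega>f]) (simp_all add: \<Omega>_def)
  then have diff: "AE z in lebesgue. z \<in> \<Omega> \<longrightarrow> ?f z > ?\<mu> \<longrightarrow> z \<in> G"
  proof eventually_elim
    case (elim z)
    show ?case
    proof (intro impI)
      assume "z \<in> \<Omega>" "?f z > ?\<mu>"
      then obtain R w where Rw: "R > 0" "z \<in> interior (kin_cyl R w)" "kin_cyl R w \<subseteq> \<Omega>"
        "?\<mu> * measure lebesgue (kin_cyl R w) < (LINT y:kin_cyl R w|lebesgue. ?f y)" using elim by blast
      have "kin_cyl R w \<subseteq> kin_cyl0 r" using Rw(3) \<Omega>D Dr by (meson order_trans)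
      then have "good R w" using Rw unfolding good_def by blast
      then show "z \<in> G" using Rw(2) unfolding G_def by blast
    qed
  qed
  have "convex ?D"
    unfolding kin_cyl0_def by (intro convex_Times convex_real_interval convex_ball)
  then have "frontier ?D \<in> null_sets lebesgue"
    using negligible_convex_frontier negligible_iff_null_sets by blast
  then have bdry: "AE z in lebesgue. z \<notin> frontier ?D" by (rule AE_not_in)
  define A where "A = {z \<in> ?D. ?f z > ?\<mu>} \<inter> G"
  have "A \<in> sets lebesgue"
  proof -
    have "(\<lambda>z. indicator ?D z * ?f z) \<in> borel_measurable lebesgue"
      using Df by (simp add: set_integrable_def borel_measurable_integrable)
    then have "{z \<in> space lebesgue. ?\<mu> < indicator ?D z * ?f z} \<in> sets lebesgue"
      by (intro borel_measurable_less) auto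
    also have "{z \<in> space lebesgue. ?\<mu> < indicator ?D z * ?f z} = {z \<in> ?D. ?f z > ?\<mu>}"
      by (auto simp: indicator_def simp del: split_paired_All)
    finally have "{z \<in> ?D. ?f z > ?\<mu>} \<in> sets lebesgue" .
    moreover have "G \<in> sets lebesgue" using Gopen by simp
    ultimately show ?thesis unfolding A_def by (rule sets.Int)
  qed
  then obtain C T where CT: "fsigma C" "T \<in> null_sets lebesgue" "C \<union> T = A" "disjnt C T"
    by (rule lebesgue_set_almost_fsigma)
  obtain F :: "nat \<Rightarrow> 'd phase set" where F: "range F \<subseteq> Collect compact" "C = \<Union>(range F)"
    using CT(1) fsigma_Union_compact by metis
  have CA: "C \<subseteq> A" using CT(3) by blast
  have Cm: "C \<in> sets lebesgue"
    unfolding F(2) using F(1) by (intro sets.countable_UN) (auto simp: compact_imp_closed)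
  have CD: "C \<subseteq> ?D" using CA unfolding A_def by blast
  have Cf: "set_integrable lebesgue C ?f" by (rule set_integrable_subset[OF Df Cm CD])
  have "AE z in lebesgue. z \<notin> T" using CT(2) by (rule AE_not_in)
  with diff bdry have "AE z in lebesgue. indicator ?D z *\<^sub>R upper_part ?\<mu> ?f z = indicator C z *\<^sub>R ?f z"
  proof eventually_elim
    case (elim z)
    show ?case
    proof (cases "z \<in> C")
      case True
      then have "z \<in> ?D" "?f z > ?\<mu>" using CA unfolding A_def by blast+
      with True show ?thesis by (simp add: upper_part_def)
    next
      case False
      have "\<not> (z \<in> ?D \<and> ?f z > ?\<mu>)"
      proof
        assume z: "z \<in> ?D \<and> ?f z > ?\<mu>"
        then have "z \<in> \<Omega>" using elim(2) closure_subset[of ?D] unfolding frontier_def \<Omega>_def by blast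
        then have "z \<in> A" using elim(1) z unfolding A_def by blast
        with False elim(3) CT(3) show False by blast
      qed
      with False show ?thesis by (auto simp: upper_part_def)
    qed
  qed
  then have eq: "?lhs = (LINT z:C|lebesgue. ?f z)"
    unfolding set_lebesgue_integral_def
    using set_integrable_upper_part[OF Df, of ?\<mu>] Cf
    by (intro integral_cong_AE) (auto simp: set_integrable_def borel_measurable_integrable)
  define K where "K n = (\<Union>i\<le>n. F i)" for n
  have Kc: "compact (K n)" for n unfolding K_def using F(1) by (intro compact_UN) auto
  have KC: "K n \<subseteq> C" for n unfolding K_def F(2) by blast
  have UK: "(\<Union>n. K n) = C" unfolding K_def F(2) by blast
  have "incseq K" unfolding K_def incseq_def by (meson UN_mono atMost_subset_iff order_refl)
  have "(\<lambda>n. LINT z:K n|lebesgue. ?f z) \<longlonglongrightarrow> (LINT z:(\<Union>n. K n)|lebesgue. ?f z)"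
  proof (rule set_integral_cont_up[OF _ \<open>incseq K\<close>])
    show "K n \<in> sets lebesgue" for n using Kc by (simp add: compact_imp_closed)
  qed (simp add: UK Cf)
  moreover have "(LINT z:K n|lebesgue. ?f z) \<le> ?rhs" for n
  proof (rule level_estimate_compact[OF sr lam big Kc])
    show "K n \<subseteq> ?D" using KC[of n] CD by (rule order_trans)
    fix z assume "z \<in> K n"
    then have "z \<in> G" using KC[of n] CA unfolding A_def by blast
    then obtain R w where "good R w" "z \<in> interior (kin_cyl R w)" unfolding G_def by blast
    then show "\<exists>R>0. \<exists>w. z \<in> interior (kin_cyl R w) \<and> kin_cyl R w \<subseteq> kin_cyl0 r \<and>
      ?\<mu> * measure lebesgue (kin_cyl R w) < (LINT y:kin_cyl R w|lebesgue. g y powr q)"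
      unfolding good_def by blast
  qed
  ultimately have "(LINT z:(\<Union>n. K n)|lebesgue. ?f z) \<le> ?rhs"
    by (intro LIMSEQ_le_const2) auto
  then show ?thesis unfolding eq UK .
qed

text \<open>Extension by zero puts all radii on one measure space, so that a single application of
  the layer-cake lemma compares Q_s with Q_r.\<close>

definition g_on :: "real \<Rightarrow> 'd phase \<Rightarrow> real" where
  "g_on r z = indicator (kin_cyl0 r) z * g z"

definition h_on :: "real \<Rightarrow> 'd phase \<Rightarrow> real" where
  "h_on r z = indicator (kin_cyl0 r) z * h z"

lemma g_on_nonneg: "0 \<le> r \<Longrightarrow> r \<le> \<gamma> \<Longrightarrow> 0 \<le> g_on r z"
  and h_on_nonneg: "0 \<le> r \<Longrightarrow> r \<le> \<gamma> \<Longrightarrow> 0 \<le> h_on r z"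
  using kin_cyl0_mono[of r \<gamma>] g_nonneg[of z] h_nonneg[of z] unfolding g_on_def h_on_def
  by (cases "z \<in> kin_cyl0 r"; auto)+

lemma measurable_g_on [measurable]:
  assumes "0 \<le> r" "r \<le> \<gamma>" shows "g_on r \<in> borel_measurable lebesgue"
proof -
  have "set_integrable lebesgue (kin_cyl0 r) g"
    by (rule set_integrable_subset[OF g_int kin_cyl0_lebesgue kin_cyl0_mono[OF assms]])
  then show ?thesis
    unfolding g_on_def set_integrable_def real_scaleR_def by (rule borel_measurable_integrable)
qed

lemma measurable_h_on [measurable]:
  assumes "0 \<le> r" "r \<le> \<gamma>" shows "h_on r \<in> borel_measurable lebesgue"
proof -
  have "set_integrable lebesgue (kin_cyl0 r) (\<lambda>z. h z powr q)"
    by (rule set_integrable_subset[OF hq_int kin_cyl0_lebesgue kin_cyl0_mono[OF assms]])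
  then have [measurable]: "(\<lambda>z. indicator (kin_cyl0 r) z * h z powr q) \<in> borel_measurable lebesgue"
    unfolding set_integrable_def real_scaleR_def by (rule borel_measurable_integrable)
  \<comment> \<open>Measurability is at hand for h^q; h itself is recovered as the q-th root, being
    nonnegative on the cylinder.\<close>
  have "(\<lambda>z. (indicator (kin_cyl0 r) z * h z powr q) powr (1 / q)) \<in> borel_measurable lebesgue"
    by (rule powr_real_measurable) (fact, simp)
  also have "(\<lambda>z. (indicator (kin_cyl0 r) z * h z powr q) powr (1 / q)) = h_on r"
  proof
    fix z
    have "z \<in> kin_cyl0 r \<Longrightarrow> 0 \<le> h z" using kin_cyl0_mono[OF assms] h_nonneg by blast
    then show "(indicator (kin_cyl0 r) z * h z powr q) powr (1 / q) = h_on r z"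
      by (cases "z \<in> kin_cyl0 r") (use q in \<open>auto simp: h_on_def powr_powr\<close>)
  qed
  finally show ?thesis .
qed

text \<open>The cuts lam / \<open>c_g\<close> for g and lam^q / (8b) for h^q become conditions on
  lam, which exhibits the constants B = \<open>c_g\<close> and B' = (8b)^(1/q) of the layer-cake
  lemma.\<close>

lemma level_estimate_nn:
  assumes sr: "1 \<le> s" "s < r" "r \<le> \<gamma>" and lam: "lam > 0"
    and big: "(9 * \<gamma>) ^ (4 * CARD('d) + 2) * total \<le> lam powr q * cyl_vol TYPE('d) * (r - s) ^ (4 * CARD('d) + 2)"
  shows "(\<integral>\<^sup>+z. (if lam < g_on s z then ennreal (g_on s z powr q) else 0) \<partial>lebesgue)
    \<le> ennreal (3 ^ (4 * CARD('d) + 2) * c_g * lam powr (q - 1)) * (\<integral>\<^sup>+z. (if lam < c_g * g_on r z then ennreal (g_on r z) else 0) \<partial>lebesgue)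
      + ennreal (3 ^ (4 * CARD('d) + 2) * (8 * b)) * (\<integral>\<^sup>+z. (if lam < (8 * b) powr (1 / q) * h_on r z then ennreal (h_on r z powr q) else 0) \<partial>lebesgue)"
proof -
  have S: "kin_cyl0 s \<subseteq> kin_cyl0 \<gamma>" and R: "kin_cyl0 r \<subseteq> kin_cyl0 \<gamma>"
    using sr by (intro kin_cyl0_mono; simp)+
  have i1: "set_integrable lebesgue (kin_cyl0 s) (upper_part (lam powr q) (\<lambda>z. g z powr q))"
    by (rule set_integrable_upper_part[OF set_integrable_subset[OF gq_int kin_cyl0_lebesgue S]]) simp
  have i2: "set_integrable lebesgue (kin_cyl0 r) (upper_part (lam / c_g) g)"
    by (rule set_integrable_upper_part[OF set_integrable_subset[OF g_int kin_cyl0_lebesgue R]]) (use lam c_g_pos in simp)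
  have i3: "set_integrable lebesgue (kin_cyl0 r) (upper_part (lam powr q / (8 * b)) (\<lambda>z. h z powr q))"
    by (rule set_integrable_upper_part[OF set_integrable_subset[OF hq_int kin_cyl0_lebesgue R]]) (use b in simp)
  have "(\<integral>\<^sup>+z. (if lam < g_on s z then ennreal (g_on s z powr q) else 0) \<partial>lebesgue)
      = (\<integral>\<^sup>+z. ennreal (indicator (kin_cyl0 s) z * upper_part (lam powr q) (\<lambda>z. g z powr q) z) \<partial>lebesgue)"
  proof (rule nn_integral_cong)
    fix z
    show "(if lam < g_on s z then ennreal (g_on s z powr q) else 0) =
      ennreal (indicator (kin_cyl0 s) z * upper_part (lam powr q) (\<lambda>z. g z powr q) z)"
    proof (cases "z \<in> kin_cyl0 s")
      case True
      then have "0 \<le> g z" using S g_nonneg by blast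
      then have "lam < g z \<longleftrightarrow> lam powr q < g z powr q"
        using lam q \<open>0 \<le> g z\<close> by (intro powr_less_powr_iff) auto
      with True show ?thesis by (simp add: g_on_def upper_part_def)
    qed (use lam in \<open>simp add: g_on_def\<close>)
  qed
  also have "\<dots> = ennreal (LINT z:kin_cyl0 s|lebesgue. upper_part (lam powr q) (\<lambda>z. g z powr q) z)"
    by (rule nn_integral_indicator_eq[OF i1]) (simp add: upper_part_nonneg)
  also have "\<dots> \<le> ennreal (3 ^ (4 * CARD('d) + 2) *
     (c_g * lam powr (q - 1) * (LINT z:kin_cyl0 r|lebesgue. upper_part (lam / c_g) g z)
      + 8 * b * (LINT z:kin_cyl0 r|lebesgue. upper_part (lam powr q / (8 * b)) (\<lambda>z. h z powr q) z)))"
    by (rule ennreal_leI[OF level_estimate[OF assms]])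
  also have "\<dots> = ennreal (3 ^ (4 * CARD('d) + 2) * c_g * lam powr (q - 1)) * ennreal (LINT z:kin_cyl0 r|lebesgue. upper_part (lam / c_g) g z)
      + ennreal (3 ^ (4 * CARD('d) + 2) * (8 * b)) * ennreal (LINT z:kin_cyl0 r|lebesgue. upper_part (lam powr q / (8 * b)) (\<lambda>z. h z powr q) z)"
  proof -
    let ?c = "3 ^ (4 * CARD('d) + 2) :: real"
    have "0 \<le> (LINT z:kin_cyl0 r|lebesgue. upper_part (lam / c_g) g z)"
      "0 \<le> (LINT z:kin_cyl0 r|lebesgue. upper_part (lam powr q / (8 * b)) (\<lambda>z. h z powr q) z)"
      using lam c_g_pos b by (intro set_integral_ge_zero upper_part_nonneg; simp)+
    then have "ennreal (?c * (x * X + y * Y)) = ennreal (?c * x) * ennreal X + ennreal (?c * y) * ennreal Y"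
      if "X \<ge> 0" "Y \<ge> 0" "x \<ge> 0" "y \<ge> 0" for x y X Y
      using that by (simp add: ennreal_mult[symmetric] ennreal_plus[symmetric] distrib_left mult.assoc del: ennreal_plus)
    from this[of "LINT z:kin_cyl0 r|lebesgue. upper_part (lam / c_g) g z" "LINT z:kin_cyl0 r|lebesgue. upper_part (lam powr q / (8 * b)) (\<lambda>z. h z powr q) z"
        "c_g * lam powr (q - 1)" "8 * b"]
    show ?thesis using lam c_g_pos b
      by (simp add: mult.assoc set_integral_ge_zero upper_part_nonneg)
  qed
  also have "ennreal (LINT z:kin_cyl0 r|lebesgue. upper_part (lam / c_g) g z) =
      (\<integral>\<^sup>+z. ennreal (indicator (kin_cyl0 r) z * upper_part (lam / c_g) g z) \<partial>lebesgue)"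
    by (rule nn_integral_indicator_eq[OF i2, symmetric]) (use lam c_g_pos in \<open>simp add: upper_part_nonneg\<close>)
  also have "\<dots> = (\<integral>\<^sup>+z. (if lam < c_g * g_on r z then ennreal (g_on r z) else 0) \<partial>lebesgue)"
    using lam c_g_pos by (intro nn_integral_cong) (auto simp: g_on_def upper_part_def indicator_def field_simps)
  also have "ennreal (LINT z:kin_cyl0 r|lebesgue. upper_part (lam powr q / (8 * b)) (\<lambda>z. h z powr q) z) =
      (\<integral>\<^sup>+z. ennreal (indicator (kin_cyl0 r) z * upper_part (lam powr q / (8 * b)) (\<lambda>z. h z powr q) z) \<partial>lebesgue)"
    by (rule nn_integral_indicator_eq[OF i3, symmetric]) (use b in \<open>simp add: upper_part_nonneg\<close>)
  also have "\<dots> = (\<integral>\<^sup>+z. (if lam < (8 * b) powr (1 / q) * h_on r z then ennreal (h_on r z powr q) else 0) \<partial>lebesgue)"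
  proof (rule nn_integral_cong)
    fix z
    show "ennreal (indicator (kin_cyl0 r) z * upper_part (lam powr q / (8 * b)) (\<lambda>z. h z powr q) z) =
       (if lam < (8 * b) powr (1 / q) * h_on r z then ennreal (h_on r z powr q) else 0)"
    proof (cases "z \<in> kin_cyl0 r")
      case True
      let ?x = "(8 * b) powr (1 / q) * h z"
      have "0 \<le> h z" using True R h_nonneg by blast
      then have "?x \<ge> 0" by simp
      then have "lam < ?x \<longleftrightarrow> lam powr q < ?x powr q"
        using lam q by (intro powr_less_powr_iff) auto
      also have "?x powr q = 8 * b * h z powr q"
        using b q \<open>0 \<le> h z\<close> by (simp add: powr_mult powr_powr)
      finally show ?thesis using True b by (simp add: h_on_def upper_part_def field_simps)
    qed (use lam in \<open>simp add: h_on_def\<close>)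
  qed
  finally show ?thesis .
qed

text \<open>K and its property \<open>hole\<close> are assumed rather than obtained in the proof: K
  has to be chosen before g and h, which are already fixed in this context.\<close>

lemma higher_integrability:
  assumes pq: "q < p" and hp: "set_integrable lebesgue (kin_cyl0 \<gamma>) (\<lambda>z. h z powr p)"
    and K: "K \<ge> 0" and hole: "\<And>\<Phi> A B M. \<lbrakk>0 \<le> A; 0 \<le> B; \<And>s. 1 \<le> s \<Longrightarrow> s \<le> \<gamma> \<Longrightarrow> \<Phi> s \<le> M;
    \<And>s r. 1 \<le> s \<Longrightarrow> s < r \<Longrightarrow> r \<le> \<gamma> \<Longrightarrow> \<Phi> s \<le> (3 ^ (4 * CARD('d) + 2) * c_g * ((p - q) / (p - 1)) * c_g powr (p - 1)) * \<Phi> r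
        + A * (r - s) powr (- (real (4 * CARD('d) + 2) * ((p - q) / q))) + B\<rbrakk> \<Longrightarrow> \<Phi> 1 \<le> K * (A + B)"
  shows "(\<integral>\<^sup>+z. ennreal (g_on 1 z powr p) \<partial>lebesgue) \<le>
    ennreal (K * (((9 * \<gamma>) ^ (4 * CARD('d) + 2) / cyl_vol TYPE('d)) powr ((p - q) / q) * total powr (p / q) 
      + 3 ^ (4 * CARD('d) + 2) * (8 * b) powr (p / q) * (LINT z:kin_cyl0 \<gamma>|lebesgue. h z powr p)))"
    (is "_ \<le> ennreal (K * (?A + ?B))")
proof -
  let ?n = "4 * CARD('d) + 2" and ?V = "cyl_vol TYPE('d)"
  let ?\<kappa> = "3 ^ ?n * c_g * ((p - q) / (p - 1)) * c_g powr (p - 1)"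
  let ?Hp = "LINT z:kin_cyl0 \<gamma>|lebesgue. h z powr p"
  have V: "?V > 0" by (rule cyl_vol_pos)
  have tot: "total \<ge> 0" by (rule set_integral_ge_zero) simp
  have Hp: "?Hp \<ge> 0" by (rule set_integral_ge_zero) simp
  have A: "?A \<ge> 0" and B: "?B \<ge> 0" using tot Hp by simp_all
  have cg1: "c_g \<ge> 1"
  proof -
    have "(4 * b) powr (1 / q) \<ge> 1" using b q by (intro ge_one_powr_ge_zero) auto
    then show ?thesis unfolding c_g_def by linarith
  qed
  have gI: "(\<integral>\<^sup>+z. ennreal (g_on s z powr q) \<partial>lebesgue) \<le> ennreal total" if "1 \<le> s" "s \<le> \<gamma>" for s
  proof -
    have "kin_cyl0 s \<subseteq> kin_cyl0 \<gamma>" using that by (intro kin_cyl0_mono) auto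
    then have "(\<integral>\<^sup>+z. ennreal (g_on s z powr q) \<partial>lebesgue) \<le> (\<integral>\<^sup>+z. ennreal (indicator (kin_cyl0 \<gamma>) z * g z powr q) \<partial>lebesgue)"
      by (intro nn_integral_mono ennreal_leI) (auto simp: g_on_def indicator_def)
    also have "\<dots> = ennreal total" by (rule nn_integral_indicator_eq[OF gq_int]) simp
    finally show ?thesis .
  qed
  have hI: "(\<integral>\<^sup>+z. ennreal (h_on r z powr p) \<partial>lebesgue) \<le> ennreal ?Hp" if "1 \<le> r" "r \<le> \<gamma>" for r
  proof -
    have "kin_cyl0 r \<subseteq> kin_cyl0 \<gamma>" using that by (intro kin_cyl0_mono) auto
    then have "(\<integral>\<^sup>+z. ennreal (h_on r z powr p) \<partial>lebesgue) \<le> (\<integral>\<^sup>+z. ennreal (indicator (kin_cyl0 \<gamma>) z * h z powr p) \<partial>lebesgue)"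
      by (intro nn_integral_mono ennreal_leI) (auto simp: h_on_def indicator_def)
    also have "\<dots> = ennreal ?Hp" by (rule nn_integral_indicator_eq[OF hp]) simp
    finally show ?thesis .
  qed
  have trunc: "(\<integral>\<^sup>+z. ennreal (g_on 1 z powr q * min (g_on 1 z) k powr (p - q)) \<partial>lebesgue) \<le> ennreal (K * (?A + ?B))"
    if k: "k \<ge> 0" for k
  proof -
    define X where "X s = (\<integral>\<^sup>+z. ennreal (g_on s z powr q * min (g_on s z) k powr (p - q)) \<partial>lebesgue)" for s
    define \<Phi> where "\<Phi> s = enn2real (X s)" for s
    \<comment> \<open>The truncated integral is finite for every radius. That the bound depends on k
      is harmless, since hole filling asks only for some bound.\<close>
    have Xb: "X s \<le> ennreal (k powr (p - q) * total)" if "1 \<le> s" "s \<le> \<gamma>" for s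
    proof -
      have "X s \<le> (\<integral>\<^sup>+z. ennreal (k powr (p - q)) * ennreal (g_on s z powr q) \<partial>lebesgue)"
        unfolding X_def
      proof (rule nn_integral_mono)
        fix z
        have "min (g_on s z) k powr (p - q) \<le> k powr (p - q)"
          using pq k g_on_nonneg[of s z] that by (intro powr_mono2) auto
        then have "g_on s z powr q * min (g_on s z) k powr (p - q) \<le> k powr (p - q) * g_on s z powr q"
          by (subst mult.commute) (rule mult_right_mono, simp_all)
        then show "ennreal (g_on s z powr q * min (g_on s z) k powr (p - q)) \<le> ennreal (k powr (p - q)) * ennreal (g_on s z powr q)"
          by (simp add: ennreal_mult[symmetric] ennreal_leI)
      qed
      also have "\<dots> = ennreal (k powr (p - q)) * (\<integral>\<^sup>+z. ennreal (g_on s z powr q) \<partial>lebesgue)"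
        using that measurable_g_on[of s] by (intro nn_integral_cmult) auto
      also have "\<dots> \<le> ennreal (k powr (p - q)) * ennreal total"
        using gI[OF that] by (rule mult_left_mono) simp
      finally show ?thesis by (simp add: ennreal_mult tot)
    qed
    have X\<Phi>: "X s = ennreal (\<Phi> s)" if "1 \<le> s" "s \<le> \<gamma>" for s
      using order_le_less_trans[OF Xb[OF that] ennreal_less_top] unfolding \<Phi>_def by simp
    have \<Phi>0: "\<Phi> s \<ge> 0" for s unfolding \<Phi>_def by simp
    have "\<Phi> 1 \<le> K * (?A + ?B)"
    proof (rule hole[OF A B])
      show "\<Phi> s \<le> k powr (p - q) * total" if "1 \<le> s" "s \<le> \<gamma>" for s
        unfolding \<Phi>_def using Xb[OF that] tot by (intro enn2real_leI) auto
      fix s r assume sr: "1 \<le> s" "s < r" "r \<le> \<gamma>"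
      \<comment> \<open>L is the least value of lam^q that satisfies \<open>big\<close>, so all
        levels above \<open>l0\<close> are allowed. It scales as (r - s)^(-n), whence l0^(p-q) gives
        the penalty exponent n (p - q)/q.\<close>
      define L where "L = (9 * \<gamma>) ^ ?n * total / (?V * (r - s) ^ ?n)"
      have L: "L \<ge> 0" using tot V sr gamma by (simp add: L_def)
      define l0 where "l0 = L powr (1 / q)"
      have l0: "l0 \<ge> 0" by (simp add: l0_def)
      have lev: "(9 * \<gamma>) ^ ?n * total \<le> t powr q * ?V * (r - s) ^ ?n" if "t > l0" for t
      proof -
        have "L = l0 powr q" using L q by (simp add: l0_def powr_powr)
        also have "\<dots> \<le> t powr q" using that l0 q by (intro powr_mono2) auto
        finally have "L * (?V * (r - s) ^ ?n) \<le> t powr q * (?V * (r - s) ^ ?n)"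
          using V sr by (intro mult_right_mono) auto
        moreover have "L * (?V * (r - s) ^ ?n) = (9 * \<gamma>) ^ ?n * total"
          using V sr by (simp add: L_def)
        ultimately show ?thesis by (simp add: mult.assoc)
      qed
      have "X s \<le> ennreal (l0 powr (p - q)) * (\<integral>\<^sup>+z. ennreal (g_on s z powr q) \<partial>lebesgue)
        + ennreal ?\<kappa> * X r
        + ennreal (3 ^ ?n * (8 * b) * ((8 * b) powr (1 / q)) powr (p - q)) * (\<integral>\<^sup>+z. ennreal (h_on r z powr p) \<partial>lebesgue)"
        unfolding X_def
      proof (rule layer_cake_absorb[OF sigma_finite_lebesgue])
        show "g_on s \<in> borel_measurable lebesgue" "g_on r \<in> borel_measurable lebesgue" "h_on r \<in> borel_measurable lebesgue"
          using sr by (intro measurable_g_on measurable_h_on; simp)+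
        show "0 \<le> g_on s z" "0 \<le> g_on r z" "0 \<le> h_on r z" for z
          using sr by (intro g_on_nonneg h_on_nonneg; simp)+
        show "(\<integral>\<^sup>+z. (if t < g_on s z then ennreal (g_on s z powr q) else 0) \<partial>lebesgue)
          \<le> ennreal (3 ^ ?n * c_g * t powr (q - 1)) * (\<integral>\<^sup>+z. (if t < c_g * g_on r z then ennreal (g_on r z) else 0) \<partial>lebesgue)
            + ennreal (3 ^ ?n * (8 * b)) * (\<integral>\<^sup>+z. (if t < (8 * b) powr (1 / q) * h_on r z then ennreal (h_on r z powr q) else 0) \<partial>lebesgue)"
          if "t > l0" for t
          using that l0 by (intro level_estimate_nn[OF sr _ lev[OF that]]) simp
      qed (use q pq l0 cg1 b k in simp_all)
      also have "\<dots> \<le> ennreal (l0 powr (p - q)) * ennreal total + ennreal ?\<kappa> * ennreal (\<Phi> r)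
        + ennreal (3 ^ ?n * (8 * b) * ((8 * b) powr (1 / q)) powr (p - q)) * ennreal ?Hp"
        using gI[of s] hI[of r] X\<Phi>[of r] sr by (intro add_mono mult_left_mono) auto
      also have "\<dots> = ennreal (l0 powr (p - q) * total + ?\<kappa> * \<Phi> r
        + 3 ^ ?n * (8 * b) * ((8 * b) powr (1 / q)) powr (p - q) * ?Hp)"
      proof -
        have sum3: "ennreal a1 * ennreal x1 + ennreal a2 * ennreal x2 + ennreal a3 * ennreal x3 = ennreal (a1 * x1 + a2 * x2 + a3 * x3)"
          if "0 \<le> a1" "0 \<le> a2" "0 \<le> a3" "0 \<le> x1" "0 \<le> x2" "0 \<le> x3" for a1 a2 a3 x1 x2 x3
          using that by (simp add: ennreal_mult)
        show ?thesis using tot Hp \<Phi>0[of r] cg1 pq q b by (intro sum3) auto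
      qed
      finally have Xs: "X s \<le> ennreal (l0 powr (p - q) * total + ?\<kappa> * \<Phi> r
        + 3 ^ ?n * (8 * b) * ((8 * b) powr (1 / q)) powr (p - q) * ?Hp)" .
      have "0 \<le> ?\<kappa>" using cg1 pq q by simp
      then have "\<Phi> s \<le> l0 powr (p - q) * total + ?\<kappa> * \<Phi> r
        + 3 ^ ?n * (8 * b) * ((8 * b) powr (1 / q)) powr (p - q) * ?Hp"
        unfolding \<Phi>_def[of s] using Xs tot Hp \<Phi>0[of r] b cg1 pq q
        by (intro enn2real_leI add_nonneg_nonneg mult_nonneg_nonneg) auto
      also have "3 ^ ?n * (8 * b) * ((8 * b) powr (1 / q)) powr (p - q) * ?Hp = ?B"
      proof -
        have "(8 * b) powr 1 * (8 * b) powr ((p - q) / q) = (8 * b) powr (p / q)"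
          unfolding powr_add[symmetric] using q by (simp add: field_simps)
        then have "(8 * b) * ((8 * b) powr (1 / q)) powr (p - q) = (8 * b) powr (p / q)"
          using b by (simp add: powr_powr)
        then show ?thesis by (simp only: mult.assoc)
      qed
      also have "l0 powr (p - q) * total = ?A * (r - s) powr (- (real ?n * ((p - q) / q)))"
      proof -
        let ?e = "(p - q) / q" and ?N = "(9 * \<gamma>) ^ ?n / ?V"
        have N: "?N \<ge> 0" using gamma V by simp
        have "L = ?N * total * (r - s) powr (- real ?n)"
        proof -
          have "(r - s) powr real ?n = (r - s) ^ ?n" using sr by (intro powr_realpow) simp
          then show ?thesis
            unfolding L_def powr_minus by (simp only: divide_inverse inverse_mult_distrib mult_ac)
        qed
        then have "l0 powr (p - q) = (?N * total * (r - s) powr (- real ?n)) powr ?e"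
          by (simp add: l0_def powr_powr)
        also have "\<dots> = ?N powr ?e * total powr ?e * (r - s) powr (- real ?n * ?e)"
          using N tot by (simp only: powr_mult powr_powr)
        finally have "l0 powr (p - q) * total = ?N powr ?e * (total * total powr ?e) * (r - s) powr (- real ?n * ?e)"
          by (simp only: mult_ac)
        also have "total * total powr ?e = total powr (p / q)"
          using powr_mult_base[OF tot, of ?e] q by (simp add: field_simps)
        finally show ?thesis unfolding mult_minus_left .
      qed
      finally show "\<Phi> s \<le> ?\<kappa> * \<Phi> r + ?A * (r - s) powr (- (real ?n * ((p - q) / q))) + ?B"
        by (simp only: add.commute)
    qed
    then show ?thesis
      using X\<Phi>[of 1] gamma unfolding X_def by (simp add: ennreal_leI)
  qed
  \<comment> \<open>Monotone convergence as k grows; the bound in \<open>trunc\<close> is free of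
    k.\<close>
  have "(\<lambda>k. \<integral>\<^sup>+z. ennreal (g_on 1 z powr q * min (g_on 1 z) (real k) powr (p - q)) \<partial>lebesgue)
    \<longlonglongrightarrow> (\<integral>\<^sup>+z. ennreal (g_on 1 z powr p) \<partial>lebesgue)"
  proof (rule nn_integral_LIMSEQ)
    have g0: "g_on 1 z \<ge> 0" for z using gamma by (intro g_on_nonneg) auto
    have [measurable]: "g_on 1 \<in> borel_measurable lebesgue" using gamma by (intro measurable_g_on) auto
    show "incseq (\<lambda>k z. ennreal (g_on 1 z powr q * min (g_on 1 z) (real k) powr (p - q)))"
      unfolding incseq_def le_fun_def
      using g0 pq by (auto intro!: ennreal_leI mult_left_mono powr_mono2)
    show "(\<lambda>z. ennreal (g_on 1 z powr q * min (g_on 1 z) (real k) powr (p - q))) \<in> borel_measurable lebesgue" for k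
      by measurable
    fix z
    obtain N :: nat where N: "g_on 1 z \<le> real N" using real_arch_simple by blast
    have "\<forall>\<^sub>F k in sequentially. ennreal (g_on 1 z powr q * min (g_on 1 z) (real k) powr (p - q)) = ennreal (g_on 1 z powr p)"
      using eventually_ge_at_top[of N]
    proof eventually_elim
      case (elim k)
      then have "min (g_on 1 z) (real k) = g_on 1 z" using N by simp
      then show ?case by (simp add: powr_add[symmetric])
    qed
    then show "(\<lambda>k. ennreal (g_on 1 z powr q * min (g_on 1 z) (real k) powr (p - q))) \<longlonglongrightarrow> ennreal (g_on 1 z powr p)"
      by (rule tendsto_eventually)
  qed
  then show ?thesis
    by (rule LIMSEQ_le_const2) (use trunc in auto)
qed

end

section \<open>Arithmetic of the contraction constant\<close>

lemma theta0_bounds: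
  assumes "q > 1" "d \<ge> 1"
  shows "0 < theta0 d q" "theta0 d q < 1/2"
proof -
  have "(1::real) \<le> 75 ^ (4 * d + 2)" by (rule one_le_power) simp
  moreover have "(1::real) < 4 powr q" using assms powr_less_mono[of 0 q 4] by simp
  ultimately have "1 * 1 < 75 ^ (4 * d + 2) * 4 powr q" by (intro mult_le_less_imp_less) auto
  then show "0 < theta0 d q" "theta0 d q < 1/2"
    by (auto simp: theta0_def divide_simps mult_ac)
qed

(* The constant 75 of theta0 leaves ample room: the bound obtained is 24 / 25^(4d+2). *)
lemma contraction_factor:
  fixes b p q :: real
  assumes "q > 1" "b > 1" "d \<ge> 1" "q < p" and p: "p < (b * q - theta0 d q) / (b - theta0 d q)"
  defines "c \<equiv> 2 * (4 * b) powr (1 / q)"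
  shows "3 ^ (4 * d + 2) * c * ((p - q) / (p - 1)) * c powr (p - 1) < 1"
proof -
  let ?t = "theta0 d q" and ?n = "4 * d + 2"
  have t: "0 < ?t" "?t < 1/2" using theta0_bounds[OF assms(1,3)] by auto
  have c: "c > 0" using assms by (simp add: c_def)
  have "p * (b - ?t) < b * q - ?t" using p t assms by (simp add: pos_less_divide_eq)
  \<comment> \<open>Two readings of the bound on p: \<open>e1\<close> is the smallness used at the
    end, while \<open>e0\<close> says that p - q is at most of order 1/b and keeps p close to
    q.\<close>
  then have e1: "b * (p - q) < ?t * (p - 1)" and e0: "(p - q) * (b - ?t) < ?t * (q - 1)"
    by (simp_all add: algebra_simps)
  have "?t * (q - 1) \<le> (b - ?t) * (q - 1)" using t assms by (intro mult_right_mono) auto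
  with e0 have "(p - q) * (b - ?t) < (q - 1) * (b - ?t)" by (simp add: mult.commute)
  then have p2: "p < 2 * q" using t assms by (simp add: mult_less_cancel_right)
  \<comment> \<open>c^p carries b^(p/q), and b is arbitrarily large. The excess b^((p-q)/q) over
    linear growth stays bounded because \<open>e0\<close> makes p - q at most of order 1/b, while ln
    b \<le> b - 1.\<close>
  have "b powr ((p - q) / q) \<le> exp 1"
  proof -
    have "ln b \<le> b - ?t" using ln_le_minus_one[of b] t assms by simp
    then have "(p - q) * ln b \<le> (p - q) * (b - ?t)" using assms by (intro mult_left_mono) auto
    also have "\<dots> \<le> 1 * (q - 1)" using e0 t assms mult_right_mono[of ?t 1 "q - 1"] by linarith
    finally have "(p - q) / q * ln b \<le> 1" using assms by (simp add: field_simps)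
    then show ?thesis using assms by (simp add: powr_def)
  qed
  also have "exp (1::real) \<le> 3" by (rule exp_le)
  finally have b3: "b powr ((p - q) / q) \<le> 3" .
  have "c powr p = 2 powr p * (4 powr (p / q) * (b powr 1 * b powr ((p - q) / q)))"
    unfolding powr_add[symmetric]
    using assms(1,2) by (simp add: c_def powr_mult powr_powr diff_divide_distrib)
  \<comment> \<open>p < 2q gives 2^p \<le> 4^q and 4^(p/q) \<le> 16. The factor 4^q is cancelled by
    the one built into \<open>theta0\<close>.\<close>
  also have "\<dots> \<le> 4 powr q * (16 * (b powr 1 * 3))"
  proof (intro mult_mono)
    have "2 powr p \<le> 2 powr (2 * q)" using p2 by simp
    also have "\<dots> = (2 powr 2) powr q" by (simp only: powr_powr)
    finally show "2 powr p \<le> 4 powr q" by simp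
    have "(4::real) powr (p / q) \<le> 4 powr 2" using p2 assms by (intro powr_mono) (auto simp: field_simps)
    then show "(4::real) powr (p / q) \<le> 16" by simp
  qed (use b3 in auto)
  finally have cp: "c powr p \<le> 48 * 4 powr q * b" using assms by simp
  have "3 ^ ?n * c * ((p - q) / (p - 1)) * c powr (p - 1) = 3 ^ ?n * ((p - q) / (p - 1)) * (c powr 1 * c powr (p - 1))"
    using c by simp
  also have "\<dots> = 3 ^ ?n * ((p - q) / (p - 1)) * c powr p"
    unfolding powr_add[symmetric] by simp
  also have "\<dots> \<le> 3 ^ ?n * ((p - q) / (p - 1)) * (48 * 4 powr q * b)"
    using cp assms by (intro mult_left_mono) auto
  also have "\<dots> = 3 ^ ?n * 48 * 4 powr q * ((b * (p - q)) / (p - 1))" by simp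
  also have "\<dots> < 3 ^ ?n * 48 * 4 powr q * ?t"
    using e1 assms by (intro mult_strict_left_mono) (auto simp: pos_divide_less_eq)
  also have "\<dots> = 24 * (3 ^ ?n / 75 ^ ?n)"
    by (simp add: theta0_def field_simps)
  also have "3 ^ ?n / 75 ^ ?n = (3 / 75 :: real) ^ ?n"
    by (simp only: power_divide)
  also have "24 * (3 / 75 :: real) ^ ?n < 1"
  proof -
    have "(3 / 75 :: real) ^ ?n \<le> (3 / 75) ^ 2" by (rule power_decreasing) auto
    then show ?thesis by (simp add: power2_eq_square)
  qed
  finally show ?thesis .
qed

section \<open>Lebesgue space membership and set integrals\<close>

lemma in_Lp_mono:
  assumes "in_Lp s S f" "S \<in> lmeasurable" "0 \<le> p" "p \<le> s"
  shows "in_Lp p S f"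
proof -
  interpret finite_measure "lebesgue_on S" by (rule finite_measure_lebesgue_on[OF assms(2)])
  have [measurable]: "f \<in> borel_measurable (lebesgue_on S)" using assms by (simp add: in_Lp_def)
  have "integrable (lebesgue_on S) (\<lambda>z. 1 + \<bar>f z\<bar> powr s)"
    using assms by (intro Bochner_Integration.integrable_add) (auto simp: in_Lp_def)
  then have "integrable (lebesgue_on S) (\<lambda>z. \<bar>f z\<bar> powr p)"
  proof (rule Bochner_Integration.integrable_bound)
    show "AE z in lebesgue_on S. norm (\<bar>f z\<bar> powr p) \<le> norm (1 + \<bar>f z\<bar> powr s)"
    proof (rule AE_I2)
      fix z
      have "\<bar>f z\<bar> powr p \<le> 1 + \<bar>f z\<bar> powr s"
      proof (cases "\<bar>f z\<bar> \<le> 1")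
        case True
        then have "\<bar>f z\<bar> powr p \<le> 1 powr p" using assms by (intro powr_mono2) auto
        then show ?thesis by (simp add: add_increasing2)
      next
        case False
        then have "\<bar>f z\<bar> powr p \<le> \<bar>f z\<bar> powr s" using assms by (intro powr_mono) auto
        then show ?thesis by simp
      qed
      then show "norm (\<bar>f z\<bar> powr p) \<le> norm (1 + \<bar>f z\<bar> powr s)" by simp
    qed
  qed measurable
  then show ?thesis using assms by (simp add: in_Lp_def)
qed

lemma in_Lp_set_integrable:
  assumes "in_Lp p S f" "S \<in> sets lebesgue" "\<And>z. z \<in> S \<Longrightarrow> 0 \<le> f z"
  shows "set_integrable lebesgue S (\<lambda>z. f z powr p)"
proof -
  have "set_integrable lebesgue S (\<lambda>z. \<bar>f z\<bar> powr p)"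
    using assms by (simp add: in_Lp_def set_integrable_def integrable_restrict_space)
  then show ?thesis
    by (subst set_integrable_cong[OF refl refl, of _ _ "\<lambda>z. \<bar>f z\<bar> powr p"]) (use assms in auto)
qed

lemma in_LpI:
  assumes "f \<in> borel_measurable (lebesgue_on S)" "S \<in> sets lebesgue" "set_integrable lebesgue S (\<lambda>z. f z powr p)"
    and "\<And>z. z \<in> S \<Longrightarrow> 0 \<le> f z"
  shows "in_Lp p S f"
proof -
  have "set_integrable lebesgue S (\<lambda>z. \<bar>f z\<bar> powr p)"
    by (subst set_integrable_cong[OF refl refl, of _ _ "\<lambda>z. f z powr p"]) (use assms in auto)
  then show ?thesis
    using assms by (simp add: in_Lp_def set_integrable_def integrable_restrict_space)
qed

lemma in_Lp_subset:
  assumes "in_Lp p T f" "S \<in> sets lebesgue" "T \<in> sets lebesgue" "S \<subseteq> T"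
  shows "in_Lp p S f"
proof -
  have "set_integrable lebesgue T (\<lambda>z. \<bar>f z\<bar> powr p)"
    using assms by (simp add: in_Lp_def set_integrable_def integrable_restrict_space)
  then have "set_integrable lebesgue S (\<lambda>z. \<bar>f z\<bar> powr p)"
    using assms(2,4) by (rule set_integrable_subset)
  then have "integrable (lebesgue_on S) (\<lambda>z. \<bar>f z\<bar> powr p)"
    using assms(2) by (simp add: set_integrable_def integrable_restrict_space)
  moreover have "f \<in> borel_measurable (lebesgue_on S)"
    using assms(1,4) unfolding in_Lp_def by (blast intro: measurable_restrict_mono)
  ultimately show ?thesis by (simp add: in_Lp_def)
qed

lemma mean_nonneg: "(\<And>z. 0 \<le> f z) \<Longrightarrow> 0 \<le> mean S f"
  by (simp add: mean_def Bochner_Integration.integral_nonneg)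

text \<open>Passes from an estimate of p-th powers to one of norms: with s the sum of the two roots,
  both x^(p/q) and y are at most s^p, which costs a factor 2 under the root.\<close>

lemma powr_le_sum_powr:
  fixes m x y p q c :: real
  assumes "0 \<le> m" "0 \<le> x" "0 \<le> y" "0 < c" "0 < p" "0 < q" and m: "m \<le> c * (x powr (p / q) + y)"
  shows "m powr (1 / p) \<le> (2 * c) powr (1 / p) * (x powr (1 / q) + y powr (1 / p))"
proof -
  let ?s = "x powr (1 / q) + y powr (1 / p)"
  have "x powr (p / q) = (x powr (1 / q)) powr p" by (simp add: powr_powr)
  also have "\<dots> \<le> ?s powr p" using assms by (intro powr_mono2) auto
  finally have 1: "x powr (p / q) \<le> ?s powr p" .
  have "y = (y powr (1 / p)) powr p" using assms by (simp add: powr_powr)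
  also have "\<dots> \<le> ?s powr p" using assms by (intro powr_mono2) auto
  finally have "x powr (p / q) + y \<le> 2 * ?s powr p" using 1 by simp
  then have "c * (x powr (p / q) + y) \<le> c * (2 * ?s powr p)" using assms by (intro mult_left_mono) auto
  with m have "m \<le> c * (2 * ?s powr p)" by linarith
  then have "m powr (1 / p) \<le> (c * (2 * ?s powr p)) powr (1 / p)" using assms by (intro powr_mono2) auto
  also have "\<dots> = (2 * c) powr (1 / p) * ?s"
    using assms by (simp add: powr_mult powr_powr)
  finally show ?thesis .
qed

theorem theorem1:
  fixes b \<theta> p q \<gamma> :: real
  assumes "\<gamma> > 1" and "q > 1" and "b > 1"
    and "0 < \<theta>" and "\<theta> < 1" and "\<theta> < theta0 CARD('d::finite) q"
  shows "\<exists>C>0. \<forall>(\<sigma>::real) (g :: 'd phase \<Rightarrow> real) (h :: 'd phase \<Rightarrow> real).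
    \<sigma> > q \<longrightarrow>
    (\<forall>z\<in>kin_cyl0 \<gamma>. g z \<ge> 0) \<longrightarrow>
    (\<forall>z\<in>kin_cyl0 \<gamma>. h z \<ge> 0) \<longrightarrow>
    in_Lp q (kin_cyl0 \<gamma>) g \<longrightarrow>
    in_Lp \<sigma> (kin_cyl0 \<gamma>) h \<longrightarrow>
    (\<forall>R>0. \<forall>z0\<in>kin_cyl0 \<gamma>. kin_cyl (\<gamma> * R) z0 \<subseteq> kin_cyl0 \<gamma> \<longrightarrow>
       mean (kin_cyl R z0) (\<lambda>z. g z powr q)
         \<le> b * (mean (kin_cyl (\<gamma> * R) z0) g powr q
                + mean (kin_cyl (\<gamma> * R) z0) (\<lambda>z. h z powr q))
           + \<theta> * mean (kin_cyl (\<gamma> * R) z0) (\<lambda>z. g z powr q)) \<longrightarrow>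
    q < pstar CARD('d) b q \<sigma> \<longrightarrow>
    p \<in> {q..<pstar CARD('d) b q \<sigma>} \<longrightarrow>
    in_Lp p (kin_cyl0 1) g \<and>
    mean (kin_cyl0 1) (\<lambda>z. g z powr p) powr (1 / p)
      \<le> C * (mean (kin_cyl0 \<gamma>) (\<lambda>z. g z powr q) powr (1 / q)
             + mean (kin_cyl0 \<gamma>) (\<lambda>z. h z powr p) powr (1 / p))"
proof -
  let ?n = "4 * CARD('d) + 2" and ?t = "theta0 CARD('d) q"
  let ?Q = "kin_cyl0 \<gamma> :: 'd phase set" and ?Q1 = "kin_cyl0 1 :: 'd phase set"
  let ?rev = "\<lambda>g h. \<forall>R>0. \<forall>z0\<in>?Q. kin_cyl (\<gamma> * R) z0 \<subseteq> ?Q \<longrightarrow>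
       mean (kin_cyl R z0) (\<lambda>z. g z powr q)
         \<le> b * (mean (kin_cyl (\<gamma> * R) z0) g powr q + mean (kin_cyl (\<gamma> * R) z0) (\<lambda>z. h z powr q))
           + \<theta> * mean (kin_cyl (\<gamma> * R) z0) (\<lambda>z. g z powr q)"
  define V where "V = cyl_vol TYPE('d)"
  define W where "W = measure lebesgue ?Q"
  define W1 where "W1 = measure lebesgue ?Q1"
  have V: "V > 0" unfolding V_def by (rule cyl_vol_pos)
  have W: "W > 0" "W1 > 0"
    unfolding W_def W1_def kin_cyl_origin[symmetric]
    using assms V by (subst measure_kin_cyl; simp add: V_def)+
  have sub: "?Q1 \<subseteq> ?Q" using assms by (intro kin_cyl0_mono) auto
  define c where "c = 2 * (4 * b) powr (1 / q)"
  \<comment> \<open>The estimate is first proved for p-th powers, with the constant quantified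
    before \<sigma>, g and h.\<close>
  have "\<exists>K3>0. \<forall>\<sigma> g h. \<sigma> > q \<longrightarrow> (\<forall>z\<in>?Q. g z \<ge> 0) \<longrightarrow> (\<forall>z\<in>?Q. h z \<ge> 0) \<longrightarrow>
    in_Lp q ?Q g \<longrightarrow> in_Lp \<sigma> ?Q h \<longrightarrow>
    ?rev g h \<longrightarrow>
    p \<in> {q..<pstar CARD('d) b q \<sigma>} \<longrightarrow>
    in_Lp p ?Q1 g \<and> mean ?Q1 (\<lambda>z. g z powr p) \<le> K3 * (mean ?Q (\<lambda>z. g z powr q) powr (p / q) + mean ?Q (\<lambda>z. h z powr p))"
  \<comment> \<open>The constant must not depend on \<sigma>, so the case distinction avoids
    \<open>pstar\<close>. If the condition fails, the range of p leaves only p = q, where the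
    inclusion of Q_1 in Q_\<gamma> suffices and the ratio of volumes is the constant.\<close>
  proof (cases "q < p \<and> p < (b * q - ?t) / (b - ?t)")
    case False
    show ?thesis
    proof (intro exI[of _ "W / W1"] conjI allI impI)
      show "W / W1 > 0" using W by simp
      fix \<sigma> g h
      assume g: "\<forall>z\<in>?Q. g z \<ge> 0" "in_Lp q ?Q g" and p: "p \<in> {q..<pstar CARD('d) b q \<sigma>}"
      have "p = q" using False p by (auto simp: pstar_def)
      have gi: "set_integrable lebesgue ?Q (\<lambda>z. g z powr q)"
        using g by (intro in_Lp_set_integrable) auto
      show "in_Lp p ?Q1 g" unfolding \<open>p = q\<close> by (rule in_Lp_subset[OF g(2) _ _ sub]) simp_all
      have "(LINT z:?Q1|lebesgue. g z powr q) \<le> (LINT z:?Q|lebesgue. g z powr q)"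
        using gi sub by (intro set_integral_mono_set) auto
      then have "mean ?Q1 (\<lambda>z. g z powr q) \<le> W / W1 * mean ?Q (\<lambda>z. g z powr q)"
        using W by (simp add: mean_eq_set_integral W_def[symmetric] W1_def[symmetric] divide_right_mono)
      also have "\<dots> \<le> W / W1 * (mean ?Q (\<lambda>z. g z powr q) powr (p / q) + mean ?Q (\<lambda>z. h z powr p))"
        using W mean_nonneg[of "\<lambda>z. g z powr q" ?Q] mean_nonneg[of "\<lambda>z. h z powr p" ?Q] assms
        by (intro mult_left_mono) (auto simp: \<open>p = q\<close>)
      finally show "mean ?Q1 (\<lambda>z. g z powr p) \<le> W / W1 * (mean ?Q (\<lambda>z. g z powr q) powr (p / q) + mean ?Q (\<lambda>z. h z powr p))"
        unfolding \<open>p = q\<close> .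
    qed
  next
    case True
    define \<kappa> where "\<kappa> = 3 ^ ?n * c * ((p - q) / (p - 1)) * c powr (p - 1)"
    have "CARD('d) \<ge> 1" by (simp add: Suc_le_eq)
    then have "\<kappa> < 1" unfolding \<kappa>_def c_def using assms True by (intro contraction_factor) auto
    have "c > 0" using assms by (simp add: c_def)
    then have "\<kappa> > 0" unfolding \<kappa>_def using True assms by simp
    have \<alpha>: "0 \<le> real ?n * ((p - q) / q)" using True assms by simp
    obtain K where K: "K > 0" and hole: "\<And>\<Phi> A B M. \<lbrakk>0 \<le> A; 0 \<le> B; \<And>s. 1 \<le> s \<Longrightarrow> s \<le> \<gamma> \<Longrightarrow> \<Phi> s \<le> M;
      \<And>s r. 1 \<le> s \<Longrightarrow> s < r \<Longrightarrow> r \<le> \<gamma> \<Longrightarrow> \<Phi> s \<le> \<kappa> * \<Phi> r + A * (r - s) powr (- (real ?n * ((p - q) / q))) + B\<rbrakk> \<Longrightarrow> \<Phi> 1 \<le> K * (A + B)"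
      using hole_filling[OF \<open>\<kappa> > 0\<close> \<open>\<kappa> < 1\<close> \<alpha> assms(1)] by metis
    define a1 where "a1 = ((9 * \<gamma>) ^ ?n / V) powr ((p - q) / q)"
    define a3 where "a3 = 3 ^ ?n * (8 * b) powr (p / q)"
    have a: "a1 \<ge> 0" "a3 > 0" using assms by (auto simp: a1_def a3_def)
    \<comment> \<open>The powers of W turn integrals over Q_\<gamma> into means, W^(p/q) for the
      g-term and W for the h-term; dividing by W1 does so on the left side.\<close>
    define K3 where "K3 = K / W1 * (a1 * W powr (p / q) + a3 * W)"
    show ?thesis
    proof (intro exI[of _ K3] conjI allI impI)
      have "a1 * W powr (p / q) + a3 * W > 0" using a W by (intro add_nonneg_pos) auto
      then show "K3 > 0" unfolding K3_def using K W by simp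
      fix \<sigma> g h
      assume \<sigma>: "\<sigma> > q" and g: "\<forall>z\<in>?Q. g z \<ge> 0" "in_Lp q ?Q g" and h: "\<forall>z\<in>?Q. h z \<ge> 0" "in_Lp \<sigma> ?Q h"
        and rev: "?rev g h"
        and p: "p \<in> {q..<pstar CARD('d) b q \<sigma>}"
      have p\<sigma>: "p \<le> \<sigma>" using p by (auto simp: pstar_def)
      have Q: "?Q \<in> lmeasurable" using assms by simp
      \<comment> \<open>Q_\<gamma> has finite measure, so exponents may be lowered: from q to 1 for
        g, from \<sigma> to q and to p for h.\<close>
      have g1: "set_integrable lebesgue ?Q (\<lambda>z. g z powr 1)"
        by (rule in_Lp_set_integrable[OF in_Lp_mono[OF g(2) Q]]) (use g(1) assms in auto)
      have gq: "set_integrable lebesgue ?Q (\<lambda>z. g z powr q)"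
        by (rule in_Lp_set_integrable[OF g(2)]) (use g(1) in auto)
      have hq: "set_integrable lebesgue ?Q (\<lambda>z. h z powr q)"
        by (rule in_Lp_set_integrable[OF in_Lp_mono[OF h(2) Q]]) (use h(1) assms \<sigma> in auto)
      have hp: "set_integrable lebesgue ?Q (\<lambda>z. h z powr p)"
        by (rule in_Lp_set_integrable[OF in_Lp_mono[OF h(2) Q]]) (use h(1) assms True p\<sigma> in auto)
      interpret R: reverse_hoelder \<gamma> q b \<theta> g h
      proof
        show "\<theta> < 1 / 2" using theta0_bounds(2)[OF assms(2) \<open>CARD('d) \<ge> 1\<close>] assms(6) by simp
        show "0 \<le> g z" if "z \<in> ?Q" for z using g(1) that by blast
        show "0 \<le> h z" if "z \<in> ?Q" for z using h(1) that by blast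
        show "set_integrable lebesgue ?Q g"
          by (subst set_integrable_cong[OF refl refl, of _ _ "\<lambda>z. g z powr 1"]) (use g1 g(1) in auto)
        show "mean (kin_cyl R z0) (\<lambda>z. g z powr q)
         \<le> b * (mean (kin_cyl (\<gamma> * R) z0) g powr q + mean (kin_cyl (\<gamma> * R) z0) (\<lambda>z. h z powr q))
           + \<theta> * mean (kin_cyl (\<gamma> * R) z0) (\<lambda>z. g z powr q)"
          if "0 < R" "z0 \<in> ?Q" "kin_cyl (\<gamma> * R) z0 \<subseteq> ?Q" for R z0
          using rev that by blast
      qed (use assms gq hq in simp_all)
      let ?I = "LINT z:?Q|lebesgue. g z powr q" and ?H = "LINT z:?Q|lebesgue. h z powr p"
      have I: "?I = W * mean ?Q (\<lambda>z. g z powr q)" "?H = W * mean ?Q (\<lambda>z. h z powr p)"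
        using W by (simp_all add: mean_eq_set_integral W_def[symmetric])
      have I0: "?I \<ge> 0" "?H \<ge> 0" by (auto intro!: set_integral_ge_zero)
      have "c = R.c_g" by (simp add: c_def R.c_g_def)
      have "(\<integral>\<^sup>+z. ennreal (R.g_on 1 z powr p) \<partial>lebesgue) \<le> ennreal (K * (a1 * ?I powr (p / q) + a3 * ?H))"
        unfolding a1_def a3_def V_def
      proof (rule R.higher_integrability[OF _ hp less_imp_le[OF K]])
        show "q < p" using True by simp
        fix \<Phi> :: "real \<Rightarrow> real" and A B M
        assume AB: "0 \<le> A" "0 \<le> B" and M: "\<And>s. 1 \<le> s \<Longrightarrow> s \<le> \<gamma> \<Longrightarrow> \<Phi> s \<le> M"
          and step: "\<And>s r. 1 \<le> s \<Longrightarrow> s < r \<Longrightarrow> r \<le> \<gamma> \<Longrightarrow>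
            \<Phi> s \<le> (3 ^ ?n * R.c_g * ((p - q) / (p - 1)) * R.c_g powr (p - 1)) * \<Phi> r
              + A * (r - s) powr (- (real ?n * ((p - q) / q))) + B"
        show "\<Phi> 1 \<le> K * (A + B)"
          by (rule hole[OF AB M]) (assumption+, unfold \<kappa>_def \<open>c = R.c_g\<close>, rule step)
      qed
      moreover have "R.g_on 1 z powr p = indicator ?Q1 z * g z powr p" for z
        by (simp add: R.g_on_def indicator_def)
      moreover have "(\<lambda>z. R.g_on 1 z powr p) \<in> borel_measurable lebesgue"
        using R.measurable_g_on[of 1] assms by (intro powr_real_measurable) auto
      ultimately have fin: "(\<integral>\<^sup>+z. ennreal (indicator ?Q1 z * g z powr p) \<partial>lebesgue) \<le> ennreal (K * (a1 * ?I powr (p / q) + a3 * ?H))"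
        and meas: "(\<lambda>z. indicator ?Q1 z * g z powr p) \<in> borel_measurable lebesgue" by simp_all
      have int: "set_integrable lebesgue ?Q1 (\<lambda>z. g z powr p)"
        unfolding set_integrable_def real_scaleR_def
        using meas order_le_less_trans[OF fin ennreal_less_top]
        by (intro integrableI_nonneg) auto
      have "(LINT z:?Q1|lebesgue. g z powr p) = enn2real (\<integral>\<^sup>+z. ennreal (indicator ?Q1 z * g z powr p) \<partial>lebesgue)"
        unfolding set_lebesgue_integral_def real_scaleR_def using meas by (intro integral_eq_nn_integral) auto
      also have "\<dots> \<le> K * (a1 * ?I powr (p / q) + a3 * ?H)"
        using fin K a I0 by (intro enn2real_leI mult_nonneg_nonneg add_nonneg_nonneg) auto
      finally have "mean ?Q1 (\<lambda>z. g z powr p) \<le> K * (a1 * ?I powr (p / q) + a3 * ?H) / W1"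
        using W by (simp add: mean_eq_set_integral W1_def[symmetric] divide_right_mono)
      also have "\<dots> = K / W1 * (a1 * W powr (p / q) * mean ?Q (\<lambda>z. g z powr q) powr (p / q) + a3 * W * mean ?Q (\<lambda>z. h z powr p))"
        unfolding I using W mean_nonneg[of "\<lambda>z. g z powr q" ?Q] by (simp add: powr_mult mult.assoc)
      also have "\<dots> \<le> K3 * (mean ?Q (\<lambda>z. g z powr q) powr (p / q) + mean ?Q (\<lambda>z. h z powr p))"
      proof -
        have "x * X + y * Y \<le> (x + y) * (X + Y)" if "0 \<le> x" "0 \<le> y" "0 \<le> X" "0 \<le> Y" for x y X Y :: real
          using that by (simp add: distrib_left distrib_right)
        from mult_left_mono[OF this[of "a1 * W powr (p / q)" "a3 * W" "mean ?Q (\<lambda>z. g z powr q) powr (p / q)" "mean ?Q (\<lambda>z. h z powr p)"], of "K / W1"]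
        show ?thesis unfolding K3_def using a W K mean_nonneg[of "\<lambda>z. h z powr p" ?Q] by (simp add: mult.assoc)
      qed
      finally show "mean ?Q1 (\<lambda>z. g z powr p) \<le> K3 * (mean ?Q (\<lambda>z. g z powr q) powr (p / q) + mean ?Q (\<lambda>z. h z powr p))" .
      show "in_Lp p ?Q1 g"
      proof (rule in_LpI[OF _ _ int])
        show "g \<in> borel_measurable (lebesgue_on ?Q1)"
          using g(2) sub unfolding in_Lp_def by (blast intro: measurable_restrict_mono)
        show "0 \<le> g z" if "z \<in> ?Q1" for z using that sub g(1) by blast
      qed simp
    qed
  qed
  then obtain K3 where K3: "K3 > 0" and main: "\<forall>\<sigma> g h. \<sigma> > q \<longrightarrow> (\<forall>z\<in>?Q. g z \<ge> 0) \<longrightarrow> (\<forall>z\<in>?Q. h z \<ge> 0) \<longrightarrow>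
    in_Lp q ?Q g \<longrightarrow> in_Lp \<sigma> ?Q h \<longrightarrow> ?rev g h \<longrightarrow> p \<in> {q..<pstar CARD('d) b q \<sigma>} \<longrightarrow>
    in_Lp p ?Q1 g \<and> mean ?Q1 (\<lambda>z. g z powr p) \<le> K3 * (mean ?Q (\<lambda>z. g z powr q) powr (p / q) + mean ?Q (\<lambda>z. h z powr p))"
    by (elim exE conjE)
  show ?thesis
  proof (intro exI[of _ "(2 * K3) powr (1 / p)"] conjI allI impI)
    show "(2 * K3) powr (1 / p) > 0" using K3 by simp
    fix \<sigma> :: real and g h :: "'d phase \<Rightarrow> real"
    assume \<sigma>: "\<sigma> > q" and g: "\<forall>z\<in>?Q. g z \<ge> 0" and h: "\<forall>z\<in>?Q. h z \<ge> 0" and gL: "in_Lp q ?Q g" and hL: "in_Lp \<sigma> ?Q h"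
        and rev: "?rev g h"
        and p: "p \<in> {q..<pstar CARD('d) b q \<sigma>}"
    have res: "in_Lp p ?Q1 g \<and> mean ?Q1 (\<lambda>z. g z powr p) \<le> K3 * (mean ?Q (\<lambda>z. g z powr q) powr (p / q) + mean ?Q (\<lambda>z. h z powr p))"
      by (rule main[THEN spec[of _ \<sigma>], THEN spec[of _ g], THEN spec[of _ h], THEN mp, OF \<sigma>, THEN mp, OF g,
            THEN mp, OF h, THEN mp, OF gL, THEN mp, OF hL, THEN mp, OF rev, THEN mp, OF p])
    from res show "in_Lp p ?Q1 g" by (rule conjunct1)
    show "mean ?Q1 (\<lambda>z. g z powr p) powr (1 / p)
      \<le> (2 * K3) powr (1 / p) * (mean ?Q (\<lambda>z. g z powr q) powr (1 / q) + mean ?Q (\<lambda>z. h z powr p) powr (1 / p))"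
      by (rule powr_le_sum_powr) (use conjunct2[OF res] K3 assms p in \<open>auto intro: mean_nonneg\<close>)
  qed
qed

end
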